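(* Fix $q>0$, $k\ge1$ and a pattern $\sigma\in\mathfrak{S}_k$. For $\pi_n\sim\mathrm{Maj}(n,q)$ let $T_\sigma(\pi_n)$ be the number of occurrences of $\sigma$ in $\pi_n$. Then the number of occurrences of $\sigma$ is asymptotically normal: as $n\to\infty$, \[ \frac{T_\sigma(\pi_n)-\mathbb{E}[T_\sigma(\pi_n)]}{n^{k-1/2}}\xrightarrow{d}N(0,s^2),\qquad s^2=\lim_{n\to\infty}\frac{\mathrm{Var}(T_\sigma(\pi_n))}{n^{2k-1}} \] (where the limit defining $s^2$ exists and $s^2\ge 0$, the case $s^2=0$ being a degenerate limit).
   Context: For $q>0$, $\mathrm{Maj}(n,q)$ is the distribution on $\mathfrak{S}_n$ with $\mathbb{P}(\mathrm{Maj}(n,q)=\pi)=q^{\mathrm{maj}(\pi)}/[n]_q!$, where $\mathrm{maj}(\pi)=\sum_{i:\pi(i)>\pi(i+1)} i$, $[m]_q=1+q+\dots+q^{m-1}$, $[n]_q!=\prod_{m=1}^n[m]_q$. A $k$-tuple of indices $i_1<\dots<i_k$ is an occurrence of $\sigma\in\mathfrak{S}_k$ in $\pi\in\mathfrak{S}_n$ if $(\pi(i_1),\dots,\pi(i_k))$ is order-isomorphic to $(\sigma(1),\dots,\sigma(k))$; $T_\sigma(\pi)$ counts such tuples. *)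

theory Defs
  imports "HOL-Probability.Probability" "HOL-Combinatorics.Permutations"
begin

text \<open>
  The symmetric group on n letters is the set of all \<open>p\<close> with \<open>p permutes {1..n}\<close>, so that
  positions and values are both numbered from 1.
\<close>

definition perms :: "nat \<Rightarrow> (nat \<Rightarrow> nat) set" where
  "perms n = {p. p permutes {1..n}}"

definition maj :: "nat \<Rightarrow> (nat \<Rightarrow> nat) \<Rightarrow> nat" where
  "maj n p = (\<Sum>i | i \<in> {1..<n} \<and> p i > p (i + 1). i)"

definition q_int :: "real \<Rightarrow> nat \<Rightarrow> real" where
  "q_int q m = (\<Sum>i<m. q ^ i)"

definition q_fact :: "real \<Rightarrow> nat \<Rightarrow> real" where
  "q_fact q n = (\<Prod>m=1..n. q_int q m)"

text \<open>
  For \<open>q > 0\<close> the total mass is 1 by MacMahon's identity; the definition does not depend on it.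
\<close>

definition Maj :: "nat \<Rightarrow> real \<Rightarrow> (nat \<Rightarrow> nat) measure" where
  "Maj n q = point_measure (perms n) (\<lambda>p. ennreal (q ^ maj n p / q_fact q n))"

definition order_isomorphic_on :: "nat set \<Rightarrow> (nat \<Rightarrow> nat) \<Rightarrow> (nat \<Rightarrow> nat) \<Rightarrow> bool" where
  "order_isomorphic_on A f g \<longleftrightarrow> (\<forall>a\<in>A. \<forall>b\<in>A. f a < f b \<longleftrightarrow> g a < g b)"

text \<open>
  An index tuple \<open>i\<^sub>1 < \<dots> < i\<^sub>k\<close> is a strictly increasing function on \<open>{1..k}\<close>; it is taken
  extensional (\<open>\<rightarrow>\<^sub>E\<close>) so that every tuple is represented, and hence counted, exactly once.
\<close>

definition occurrences :: "nat \<Rightarrow> (nat \<Rightarrow> nat) \<Rightarrow> nat \<Rightarrow> (nat \<Rightarrow> nat) \<Rightarrow> (nat \<Rightarrow> nat) set" where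
  "occurrences k \<sigma> n p =
     {i \<in> {1..k} \<rightarrow>\<^sub>E {1..n}.
        strict_mono_on {1..k} i \<and> order_isomorphic_on {1..k} (\<lambda>a. p (i a)) \<sigma>}"

definition pattern_count :: "nat \<Rightarrow> (nat \<Rightarrow> nat) \<Rightarrow> nat \<Rightarrow> (nat \<Rightarrow> nat) \<Rightarrow> real" where
  "pattern_count k \<sigma> n p = real (card (occurrences k \<sigma> n p))"

text \<open>
  The law \<open>N(0, s\<^sup>2)\<close>, parametrised by the standard deviation like \<^const>\<open>normal_density\<close>, and
  degenerating to the point mass at 0 for \<open>s = 0\<close>.
\<close>

definition centered_normal :: "real \<Rightarrow> real measure" where
  "centered_normal s =
     (if s = 0 then return borel 0 else density lborel (\<lambda>x. ennreal (normal_density 0 s x)))"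

end

theory Submission
  imports Defs "HOL-Real_Asymp.Real_Asymp"
begin

text \<open>
  Give the values \<open>v = 1, \<dots>, n\<close> independent identically distributed labels \<open>x\<^sub>v\<close> and list them by
  decreasing label. If the labels are geometric with ratio \<open>q < 1\<close> and ties are broken in favour of
  the smaller value, the resulting permutation has exactly the law \<open>Maj(n, q)\<close>: the event that it
  equals a given \<open>p\<close> says that the labels decrease weakly along \<open>p\<close>, strictly at the descents, and
  its probability is computed by memorylessness. Uniform labels give \<open>q = 1\<close>; geometric labels with
  ratio \<open>1/q\<close> and the opposite tie rule (strict decrease at the ascents) give \<open>q > 1\<close>.

  Hence \<open>T\<^sub>\<sigma>\<close> is an incomplete U-statistic of the labels, summed over increasing index tuples.
  Attaching to every label an independent uniform variable, whose order replaces the order of the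
  indices, turns it into a sum over all index tuples of a kernel evaluated at i.i.d. pairs, with the
  same law. Hoeffding's decomposition writes this sum as its mean plus \<open>n\<^sup>k\<^sup>-\<^sup>1\<close> times a sum of \<open>n\<close>
  i.i.d. variables plus a remainder with second moment \<open>O(n\<^sup>2\<^sup>k\<^sup>-\<^sup>2)\<close>, so the classical central limit
  theorem applies.
\<close>

section \<open>Sequences of independent identically distributed variables\<close>

text \<open>If one sums only over increasing index tuples of fixed labels, the projection of the
  kernel onto \<open>x v\<close> carries weights counting the tuples with \<open>v\<close> in each
  position, hence depending on v / n: the linear part has independent but not identically
  distributed terms. The marks make the place of an index part of the i.i.d. data, which is why the
  classical theorem suffices. The exponent maj arises as follows: a strict drop after position i
  pushes each of the first i labels up by one unit, which costs r ^ i for geometric labels of ratio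
  r. With strict drops at the ascents the exponent is n (n - 1) / 2 minus the major index, and r = 1
  / q restores the sign. The remainder is one power of n below the normalising variance because
  orthogonality leaves only pairs of injective tuples sharing at least two indices. As s may vanish
  (for k = 1 the count is constant), the limits are proved through characteristic functions, whose
  Gaussian form remains valid at s = 0.\<close>

definition depends_on :: "'i set \<Rightarrow> (('i \<Rightarrow> 'a) \<Rightarrow> 'b) \<Rightarrow> bool" where
  "depends_on I f \<longleftrightarrow> (\<forall>w w'. (\<forall>i\<in>I. w i = w' i) \<longrightarrow> f w = f w')"

lemma depends_onD: "depends_on I f \<Longrightarrow> (\<And>i. i \<in> I \<Longrightarrow> w i = w' i) \<Longrightarrow> f w = f w'"
  unfolding depends_on_def by blast

lemma depends_on_reindex:
  assumes "depends_on I f"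
  shows "depends_on (i ` I) (\<lambda>w. f (\<lambda>a. w (i a)))"
  unfolding depends_on_def by (auto intro!: depends_onD[OF assms])

lemma depends_on_upd:
  assumes "depends_on I f"
  shows "depends_on (I - {v}) (\<lambda>w. f (w(v := x)))"
  unfolding depends_on_def by (auto intro!: depends_onD[OF assms])

locale iid_seq = prob_space M for M :: "'a measure"
begin

text \<open>The index set is all of \<open>nat\<close>, so that one probability space serves every n
  at once.\<close>

definition P :: "(nat \<Rightarrow> 'a) measure" where "P = PiM UNIV (\<lambda>_. M)"

sublocale seq: prob_space P
  unfolding P_def by (intro prob_space_PiM prob_space_axioms)

lemma space_P: "space P = UNIV \<rightarrow>\<^sub>E space M"
  by (simp add: P_def space_PiM)

lemma measurable_coord [measurable]: "(\<lambda>w. w i) \<in> measurable P M"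
  unfolding P_def by simp

lemma measurable_into_P: "(\<And>i. (\<lambda>w. f w i) \<in> measurable N M) \<Longrightarrow> f \<in> measurable N P"
  unfolding P_def by (rule measurable_PiM_single') (auto simp: PiE_def space_PiM dest: measurable_space)

lemma measurable_reindex: "(\<lambda>w a. w (i a)) \<in> measurable P P"
  by (rule measurable_into_P) measurable

lemma measurable_upd: "(\<lambda>(x, w). w(v := x)) \<in> measurable (M \<Otimes>\<^sub>M P) P"
proof (rule measurable_into_P)
  fix i show "(\<lambda>w. (case w of (x, w) \<Rightarrow> w(v := x)) i) \<in> M \<Otimes>\<^sub>M P \<rightarrow>\<^sub>M M"
    by (cases "i = v") (auto simp: case_prod_unfold)
qed

lemma measurable_upd1: "x \<in> space M \<Longrightarrow> (\<lambda>w. w(v := x)) \<in> measurable P P"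
proof (rule measurable_into_P)
  fix i assume "x \<in> space M" then show "(\<lambda>w. (w(v := x)) i) \<in> P \<rightarrow>\<^sub>M M"
    by (cases "i = v") auto
qed

lemma distr_upd: "distr (M \<Otimes>\<^sub>M P) P (\<lambda>(x, w). w(v := x)) = P"
  using distr_pair_PiM_eq_PiM[of UNIV "\<lambda>_. M" v] prob_space_axioms by (simp add: P_def)

text \<open>Fubini together with the invariance of \<open>P\<close> under overwriting a coordinate
  by an independent copy. It stands in for conditioning: the inner integral is an explicit,
  everywhere defined version of the conditional expectation given that coordinate \<open>v\<close>
  equals \<open>x\<close>.\<close>

lemma integral_resample:
  fixes f :: "(nat \<Rightarrow> 'a) \<Rightarrow> real"
  assumes [measurable]: "f \<in> borel_measurable P" and bnd: "\<And>w. \<bar>f w\<bar> \<le> C"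
  shows "(\<integral>w. f w \<partial>P) = (\<integral>x. \<integral>w. f (w(v := x)) \<partial>P \<partial>M)"
proof -
  interpret MP: pair_prob_space M P ..
  have "(\<integral>w. f w \<partial>P) = (\<integral>w. f w \<partial>distr (M \<Otimes>\<^sub>M P) P (\<lambda>(x, w). w(v := x)))"
    by (simp add: distr_upd)
  also have "\<dots> = (\<integral>z. f (case z of (x, w) \<Rightarrow> w(v := x)) \<partial>(M \<Otimes>\<^sub>M P))"
    by (rule integral_distr[OF measurable_upd assms(1)])
  also have "\<dots> = (\<integral>x. \<integral>w. f (w(v := x)) \<partial>P \<partial>M)"
  proof -
    have "(\<lambda>z. f (case z of (x, w) \<Rightarrow> w(v := x))) \<in> borel_measurable (M \<Otimes>\<^sub>M P)"
      by (rule measurable_compose[OF measurable_upd assms(1)])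
    then have "integrable (M \<Otimes>\<^sub>M P) (\<lambda>z. f (case z of (x, w) \<Rightarrow> w(v := x)))"
      by (intro MP.integrable_const_bound[where B = C]) (auto simp: bnd)
    from MP.integral_fst'[OF this] show ?thesis by simp
  qed
  finally show ?thesis .
qed

lemma distr_coord: "distr P M (\<lambda>w. w i) = M"
  unfolding P_def using distr_PiM_component[of UNIV "\<lambda>_. M" i] prob_space_axioms by simp

lemma distr_reindex_restrict:
  assumes "inj_on i I"
  shows "distr P (PiM I (\<lambda>_. M)) (\<lambda>w. restrict (\<lambda>a. w (i a)) I) = PiM I (\<lambda>_. M)"
  unfolding P_def using distr_PiM_reindex[of UNIV "\<lambda>_. M" i I] assms prob_space_axioms
  by (simp add: restrict_def)

lemma indep_coords_reindex:
  fixes f :: "nat \<Rightarrow> nat"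
  assumes "inj f"
  shows "seq.indep_vars (\<lambda>_. M) (\<lambda>i w. w (f i)) UNIV"
proof (subst seq.indep_vars_iff_distr_eq_PiM)
  show "distr P (Pi\<^sub>M UNIV (\<lambda>i. M)) (\<lambda>x. \<lambda>i\<in>UNIV. x (f i)) = Pi\<^sub>M UNIV (\<lambda>i. distr P M (\<lambda>w. w (f i)))"
    unfolding distr_coord by (rule distr_reindex_restrict[OF assms])
qed auto

lemma indep_coords: "seq.indep_vars (\<lambda>_. M) (\<lambda>i w. w i) (UNIV :: nat set)"
  using indep_coords_reindex[of "\<lambda>i. i"] by simp

text \<open>Fill the coordinates outside \<open>I\<close> with a fixed point \<open>c\<close> of the
  space and apply \<open>f\<close>. This lets kernels be functions of whole sequences, while
  independence and change of indices are taken from the finite or partial products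
  \<open>PiM I\<close>.\<close>

lemma depends_on_factor:
  fixes f :: "(nat \<Rightarrow> 'a) \<Rightarrow> 'b"
  assumes f: "f \<in> measurable P N" and dep: "depends_on I f"
  obtains g where "g \<in> measurable (PiM I (\<lambda>_. M)) N" "\<And>w. f w = g (restrict w I)"
proof -
  obtain c where c: "c \<in> space M" using not_empty by blast
  let ?e = "\<lambda>y i. if i \<in> I then y i else c"
  have "?e \<in> measurable (PiM I (\<lambda>_. M)) P"
  proof (rule measurable_into_P)
    fix i show "(\<lambda>y. if i \<in> I then y i else c) \<in> measurable (PiM I (\<lambda>_. M)) M"
      by (cases "i \<in> I") (use c in auto)
  qed
  from measurable_compose[OF this f] show ?thesis
    by (rule that) (auto intro!: depends_onD[OF dep])
qed

lemma integral_mult_disjoint: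
  fixes f g :: "(nat \<Rightarrow> 'a) \<Rightarrow> real"
  assumes f [measurable]: "f \<in> borel_measurable P" and g [measurable]: "g \<in> borel_measurable P"
    and "\<And>w. \<bar>f w\<bar> \<le> C" "\<And>w. \<bar>g w\<bar> \<le> D"
    and "depends_on I f" "depends_on J g" and "I \<inter> J = {}"
  shows "(\<integral>w. f w * g w \<partial>P) = (\<integral>w. f w \<partial>P) * (\<integral>w. g w \<partial>P)"
proof -
  obtain f' where f': "f' \<in> borel_measurable (PiM I (\<lambda>_. M))" "\<And>w. f w = f' (restrict w I)"
    using depends_on_factor[OF f \<open>depends_on I f\<close>] by blast
  obtain g' where g': "g' \<in> borel_measurable (PiM J (\<lambda>_. M))" "\<And>w. g w = g' (restrict w J)"
    using depends_on_factor[OF g \<open>depends_on J g\<close>] by blast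
  have "seq.indep_var (PiM I (\<lambda>_. M)) (\<lambda>w. restrict w I) (PiM J (\<lambda>_. M)) (\<lambda>w. restrict w J)"
    using seq.indep_var_restrict[OF indep_coords \<open>I \<inter> J = {}\<close>, unfolded restrict_def] by (simp add: restrict_def)
  from seq.indep_var_compose[OF this f'(1) g'(1)]
  have "seq.indep_var borel f borel g"
    by (simp add: o_def f'(2)[symmetric] g'(2)[symmetric])
  moreover have "integrable P f" "integrable P g"
    by (rule seq.integrable_const_bound[where B = C] seq.integrable_const_bound[where B = D],
        use assms in auto)+
  ultimately show ?thesis
    by (rule seq.indep_var_lebesgue_integral)
qed

text \<open>Freeze the only coordinate that can be shared: the two factors then depend on disjoint
  sets of coordinates, the integral of the product splits, and the factor belonging to
  \<open>f\<close> is zero.\<close>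

lemma integral_mult_shared:
  fixes f g :: "(nat \<Rightarrow> 'a) \<Rightarrow> real"
  assumes f [measurable]: "f \<in> borel_measurable P" and g [measurable]: "g \<in> borel_measurable P"
    and fC: "\<And>w. \<bar>f w\<bar> \<le> C" and gD: "\<And>w. \<bar>g w\<bar> \<le> D"
    and "depends_on I f" "depends_on J g" and IJ: "I \<inter> J \<subseteq> {v}"
    and zero: "\<And>x. x \<in> space M \<Longrightarrow> (\<integral>w. f (w(v := x)) \<partial>P) = 0"
  shows "(\<integral>w. f w * g w \<partial>P) = 0"
proof -
  have "\<bar>f w * g w\<bar> \<le> C * D" for w
    unfolding abs_mult by (intro mult_mono fC gD) (auto intro: order_trans[OF abs_ge_zero fC])
  then have "(\<integral>w. f w * g w \<partial>P) = (\<integral>x. \<integral>w. f (w(v := x)) * g (w(v := x)) \<partial>P \<partial>M)"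
    by (intro integral_resample) auto
  also have "\<dots> = (\<integral>x. 0 \<partial>M)"
  proof (rule Bochner_Integration.integral_cong[OF refl])
    fix x assume x: "x \<in> space M"
    note fm = measurable_compose[OF measurable_upd1[OF x] f]
      and gm = measurable_compose[OF measurable_upd1[OF x] g]
    have "(\<integral>w. f (w(v := x)) * g (w(v := x)) \<partial>P) =
          (\<integral>w. f (w(v := x)) \<partial>P) * (\<integral>w. g (w(v := x)) \<partial>P)"
      by (rule integral_mult_disjoint[OF fm gm fC gD
            depends_on_upd[OF \<open>depends_on I f\<close>] depends_on_upd[OF \<open>depends_on J g\<close>]])
         (use IJ in auto)
    then show "(\<integral>w. f (w(v := x)) * g (w(v := x)) \<partial>P) = 0"
      using zero[OF x] by simp
  qed
  finally show ?thesis by simp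
qed

text \<open>Exchangeability: the family of coordinates seen by \<open>f\<close> is i.i.d. both
  before and after an injective change of indices, so both sides are images of the same product
  measure.\<close>

lemma distr_reindex:
  fixes f :: "(nat \<Rightarrow> 'a) \<Rightarrow> 'b"
  assumes f: "f \<in> measurable P N" and dep: "depends_on I f" and i: "inj_on i I"
  shows "distr P N (\<lambda>w. f (\<lambda>a. w (i a))) = distr P N f"
proof -
  obtain g where g: "g \<in> measurable (PiM I (\<lambda>_. M)) N" "\<And>w. f w = g (restrict w I)"
    using depends_on_factor[OF f dep] by blast
  have rm: "(\<lambda>w. restrict (\<lambda>a. w (j a)) I) \<in> measurable P (PiM I (\<lambda>_. M))" for j
    by (rule measurable_restrict) measurable
  have *: "distr P N (\<lambda>w. f (\<lambda>a. w (j a))) = distr (PiM I (\<lambda>_. M)) N g" if "inj_on j I" for j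
  proof -
    have "distr P N (\<lambda>w. f (\<lambda>a. w (j a))) =
        distr (distr P (PiM I (\<lambda>_. M)) (\<lambda>w. restrict (\<lambda>a. w (j a)) I)) N g"
      by (subst distr_distr[OF g(1) rm]) (simp add: o_def g(2))
    then show ?thesis
      by (simp only: distr_reindex_restrict[OF that])
  qed
  show ?thesis
    using *[OF i] *[of "\<lambda>a. a"] by simp
qed

lemma integral_reindex:
  fixes f :: "(nat \<Rightarrow> 'a) \<Rightarrow> real"
  assumes [measurable]: "f \<in> borel_measurable P" and "depends_on I f" and "inj_on i I"
  shows "(\<integral>w. f (\<lambda>a. w (i a)) \<partial>P) = (\<integral>w. f w \<partial>P)"
proof -
  have [measurable]: "(\<lambda>w. f (\<lambda>a. w (i a))) \<in> borel_measurable P"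
    by (rule measurable_compose[OF measurable_reindex assms(1)])
  have "(\<integral>w. f (\<lambda>a. w (i a)) \<partial>P) = (\<integral>y. y \<partial>distr P borel (\<lambda>w. f (\<lambda>a. w (i a))))"
    by (subst integral_distr) auto
  also have "\<dots> = (\<integral>w. f w \<partial>P)"
    by (subst distr_reindex[OF assms], subst integral_distr) auto
  finally show ?thesis .
qed

end

section \<open>Sums of a kernel over index tuples\<close>

abbreviation tuples :: "nat \<Rightarrow> nat \<Rightarrow> (nat \<Rightarrow> nat) set" where
  "tuples k n \<equiv> {1..k} \<rightarrow>\<^sub>E {1..n}"

lemma finite_tuples [simp]: "finite (tuples k n)"
  by (intro finite_PiE) auto

lemma card_tuples: "card (tuples k n) = n ^ k"
  by (simp add: card_PiE)

text \<open>Each value in {1..n} is the j-th entry of n ^ (k - 1) tuples.\<close>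

lemma sum_tuples_component:
  fixes f :: "nat \<Rightarrow> real"
  assumes j: "j \<in> {1..k}"
  shows "(\<Sum>i\<in>tuples k n. f (i j)) = real n ^ (k - 1) * (\<Sum>v=1..n. f v)"
proof -
  let ?K = "{1..k} - {j}"
  have K: "{1..k} = insert j ?K" using j by auto
  have inj: "inj_on (\<lambda>(y, g). g(j := y)) ({1..n} \<times> (?K \<rightarrow>\<^sub>E {1..n}))"
    by (rule inj_combinator) auto
  have eq: "tuples k n = (\<lambda>(y, g). g(j := y)) ` ({1..n} \<times> (?K \<rightarrow>\<^sub>E {1..n}))"
    by (subst K, subst PiE_insert_eq) simp
  have "(\<Sum>i\<in>tuples k n. f (i j)) = (\<Sum>z\<in>{1..n} \<times> (?K \<rightarrow>\<^sub>E {1..n}). f (fst z))"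
    unfolding eq sum.reindex[OF inj] by (rule sum.cong[OF refl]) (simp add: case_prod_unfold)
  also have "\<dots> = (\<Sum>y\<in>{1..n}. \<Sum>g\<in>(?K \<rightarrow>\<^sub>E {1..n}). f y)"
    by (simp only: sum.cartesian_product case_prod_unfold)
  also have "\<dots> = real n ^ (k - 1) * (\<Sum>v=1..n. f v)"
    using j by (simp add: card_PiE sum_distrib_left)
  finally show ?thesis .
qed

text \<open>Choose two positions a, b with equal entries, in at most k ^ 2 ways; the tuple is then
  determined by its entries away from b.\<close>

lemma card_non_injective_tuples:
  "card {i \<in> tuples k n. \<not> inj_on i {1..k}} \<le> k ^ 2 * n ^ (k - 1)"
proof -
  let ?I = "{(a, b). a \<in> {1..k} \<and> b \<in> {1..k} \<and> a \<noteq> b}"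
  let ?B = "\<lambda>(a, b). {i \<in> tuples k n. i a = i b}"
  have fin: "finite ?I"
    by (rule finite_subset[of _ "{1..k} \<times> {1..k}"]) auto
  have "card (?B p) \<le> n ^ (k - 1)" if "p \<in> ?I" for p
  proof -
    obtain a b where p: "p = (a, b)" and ab: "a \<in> {1..k}" "b \<in> {1..k}" "a \<noteq> b"
      using \<open>p \<in> ?I\<close> by auto
    have "inj_on (\<lambda>i. restrict i ({1..k} - {b})) {i \<in> tuples k n. i a = i b}"
    proof (rule inj_onI, clarify)
      fix i i' assume i: "i \<in> tuples k n" "i' \<in> tuples k n" "i a = i b" "i' a = i' b"
        and eq: "restrict i ({1..k} - {b}) = restrict i' ({1..k} - {b})"
      have "i c = i' c" if "c \<in> {1..k} - {b}" for c
        using fun_cong[OF eq, of c] that by simp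
      then have "i c = i' c" if "c \<in> {1..k}" for c
        using that i(3,4) ab by (cases "c = b") (metis DiffI singletonD)+
      then show "i = i'"
        using i by (intro PiE_ext[of i "{1..k}" _ i']) auto
    qed
    then have "card {i \<in> tuples k n. i a = i b} \<le> card (({1..k} - {b}) \<rightarrow>\<^sub>E {1..n})"
    proof (rule card_inj_on_le)
      show "finite (({1..k} - {b}) \<rightarrow>\<^sub>E {1..n})"
        by (rule finite_PiE) simp_all
      show "(\<lambda>i. restrict i ({1..k} - {b})) ` {i \<in> tuples k n. i a = i b} \<subseteq> ({1..k} - {b}) \<rightarrow>\<^sub>E {1..n}"
        unfolding image_subset_iff restrict_PiE_iff by blast
    qed
    also have "\<dots> = n ^ (k - 1)"
      using ab by (simp add: card_PiE)
    finally show ?thesis using p by simp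
  qed
  moreover have "{i \<in> tuples k n. \<not> inj_on i {1..k}} \<subseteq> (\<Union>p\<in>?I. ?B p)"
    unfolding inj_on_def by blast
  then have "card {i \<in> tuples k n. \<not> inj_on i {1..k}} \<le> card (\<Union>p\<in>?I. ?B p)"
  proof (intro card_mono finite_UN_I fin)
    show "finite (?B p)" for p
      by (rule finite_subset[OF _ finite_tuples[of k n]]) (simp only: case_prod_unfold, blast)
  qed
  ultimately have "card {i \<in> tuples k n. \<not> inj_on i {1..k}} \<le> card ?I * n ^ (k - 1)"
    using card_UN_le[OF fin, of ?B] sum_bounded_above[of ?I "\<lambda>p. card (?B p)" "n ^ (k - 1)"]
    by force
  also have "card ?I \<le> card ({1..k} \<times> {1..k})"
    by (intro card_mono) auto
  finally show ?thesis
    by (simp add: power2_eq_square)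
qed

text \<open>For injective \<open>i'\<close> this says that the two tuples share at least two
  indices. As \<open>a = b\<close> is allowed, a repeated entry of \<open>i'\<close> that also
  occurs in \<open>i\<close> counts as an overlap too; the relation is not symmetric.\<close>

definition overlapping :: "nat \<Rightarrow> (nat \<Rightarrow> nat) \<Rightarrow> (nat \<Rightarrow> nat) \<Rightarrow> bool" where
  "overlapping k i i' \<longleftrightarrow> (\<exists>a\<in>{1..k}. \<exists>b\<in>{1..k}. \<exists>a'\<in>{1..k}. \<exists>b'\<in>{1..k}.
     a' \<noteq> b' \<and> i a = i' a' \<and> i b = i' b')"

text \<open>There are at most k ^ 4 choices of positions. Given them, \<open>i\<close> is free, two
  entries of \<open>i'\<close> are read off from \<open>i\<close>, and k - 2 entries of
  \<open>i'\<close> remain.\<close>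

lemma card_overlapping_tuples:
  "card {(i, i') \<in> tuples k n \<times> tuples k n. overlapping k i i'} \<le> k ^ 4 * n ^ (2 * k - 2)"
proof -
  let ?K = "{1..k}"
  let ?I = "{(a, b, a', b'). a \<in> ?K \<and> b \<in> ?K \<and> a' \<in> ?K \<and> b' \<in> ?K \<and> a' \<noteq> b'}"
  let ?B = "\<lambda>(a, b, a', b'). {(i, i') \<in> tuples k n \<times> tuples k n. i a = i' a' \<and> i b = i' b'}"
  have fin: "finite ?I"
    by (rule finite_subset[of _ "?K \<times> ?K \<times> ?K \<times> ?K"]) auto
  have "card (?B p) \<le> n ^ (2 * k - 2)" if "p \<in> ?I" for p
  proof -
    obtain a b a' b' where p: "p = (a, b, a', b')"
      and ab: "a \<in> ?K" "b \<in> ?K" "a' \<in> ?K" "b' \<in> ?K" "a' \<noteq> b'"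
      using \<open>p \<in> ?I\<close> by auto
    let ?S = "{(i, i') \<in> tuples k n \<times> tuples k n. i a = i' a' \<and> i b = i' b'}"
    have "inj_on (\<lambda>(i, i'). (i, restrict i' (?K - {a', b'}))) ?S"
    proof (rule inj_onI)
      fix p q assume pq: "p \<in> ?S" "q \<in> ?S"
        and eq: "(\<lambda>(i, i'). (i, restrict i' (?K - {a', b'}))) p = (\<lambda>(i, i'). (i, restrict i' (?K - {a', b'}))) q"
      obtain i i' where p: "p = (i, i')" by fastforce
      obtain i'' where q: "q = (i, i'')" using eq p by (cases q) auto
      have i: "i' \<in> tuples k n" "i'' \<in> tuples k n" "i'' a' = i' a'" "i'' b' = i' b'"
        using pq p q by auto
      have eq: "restrict i' (?K - {a', b'}) = restrict i'' (?K - {a', b'})"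
        using eq p q by auto
      have "i' c = i'' c" if "c \<in> ?K - {a', b'}" for c
        using fun_cong[OF eq, of c] that by simp
      then have "i' c = i'' c" if "c \<in> ?K" for c
        using that i(3,4) by (cases "c = a'"; cases "c = b'") auto
      then have "i' = i''"
        using i by (intro PiE_ext[of i' "?K" _ i'']) auto
      then show "p = q" using p q by simp
    qed
    then have "card ?S \<le> card (tuples k n \<times> ((?K - {a', b'}) \<rightarrow>\<^sub>E {1..n}))"
    proof (rule card_inj_on_le)
      show "finite (tuples k n \<times> ((?K - {a', b'}) \<rightarrow>\<^sub>E {1..n}))"
        by (intro finite_cartesian_product finite_PiE) simp_all
      have "restrict i' (?K - {a', b'}) \<in> (?K - {a', b'}) \<rightarrow>\<^sub>E {1..n}" if "i' \<in> tuples k n" for i'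
        using that unfolding restrict_PiE_iff by blast
      then show "(\<lambda>(i, i'). (i, restrict i' (?K - {a', b'}))) ` ?S
          \<subseteq> tuples k n \<times> ((?K - {a', b'}) \<rightarrow>\<^sub>E {1..n})"
        by (intro image_subsetI) (simp only: mem_Collect_eq case_prod_unfold mem_Times_iff fst_conv snd_conv)
    qed
    also have "\<dots> = n ^ k * n ^ (k - 2)"
      using ab by (simp add: card_PiE card_cartesian_product card_Diff_subset numeral_2_eq_2)
    also have "\<dots> = n ^ (2 * k - 2)"
    proof -
      \<comment> \<open>The distinct positions \<open>a'\<close> and \<open>b'\<close> force this,
        so the subtractions in the exponents are not truncated.\<close>
      have "k \<ge> 2" using ab by auto
      then have "k + (k - 2) = 2 * k - 2" by simp
      then show ?thesis by (metis power_add)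
    qed
    finally show ?thesis using p by simp
  qed
  moreover have "{(i, i') \<in> tuples k n \<times> tuples k n. overlapping k i i'} \<subseteq> (\<Union>p\<in>?I. ?B p)"
  proof clarify
    fix i i' assume i: "i \<in> tuples k n" "i' \<in> tuples k n" and "overlapping k i i'"
    then obtain a b a' b' where "a \<in> ?K" "b \<in> ?K" "a' \<in> ?K" "b' \<in> ?K" "a' \<noteq> b'"
      "i a = i' a'" "i b = i' b'"
      unfolding overlapping_def by blast
    then show "(i, i') \<in> (\<Union>p\<in>?I. ?B p)"
      using i by (intro UN_I[of "(a, b, a', b')"]) blast+
  qed
  then have "card {(i, i') \<in> tuples k n \<times> tuples k n. overlapping k i i'} \<le> card (\<Union>p\<in>?I. ?B p)"
  proof (intro card_mono finite_UN_I fin)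
    show "finite (?B p)" for p
      by (rule finite_subset[OF _ finite_cartesian_product[OF finite_tuples[of k n] finite_tuples[of k n]]])
         (cases p rule: prod_cases4, blast)
  qed
  ultimately have "card {(i, i') \<in> tuples k n \<times> tuples k n. overlapping k i i'}
      \<le> card ?I * n ^ (2 * k - 2)"
    using card_UN_le[OF fin, of ?B] sum_bounded_above[of ?I "\<lambda>p. card (?B p)" "n ^ (2 * k - 2)"]
    by force
  also have "card ?I \<le> card (?K \<times> ?K \<times> ?K \<times> ?K)"
    by (intro card_mono) auto
  finally show ?thesis
    by (simp add: card_cartesian_product power4_eq_xxxx mult.assoc)
qed

lemma not_overlapping_imp:
  assumes "\<not> overlapping k i i'" and "k \<ge> 1"
  shows "\<exists>j\<in>{1..k}. i ` {1..k} \<inter> i' ` {1..k} \<subseteq> {i j}"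
proof (cases "i ` {1..k} \<inter> i' ` {1..k} = {}")
  case True
  then show ?thesis using \<open>k \<ge> 1\<close> by (intro bexI[of _ 1]) auto
next
  case False
  then obtain j j' where j: "j \<in> {1..k}" "j' \<in> {1..k}" "i j = i' j'" by blast
  have "u = i j" if "u \<in> i ` {1..k} \<inter> i' ` {1..k}" for u
  proof -
    obtain b b' where b: "b \<in> {1..k}" "b' \<in> {1..k}" "u = i b" "u = i' b'" using \<open>u \<in> _\<close> by blast
    have "b' = j'"
    proof (rule ccontr)
      assume "b' \<noteq> j'"
      then have "overlapping k i i'"
        unfolding overlapping_def using j b by metis
      with assms show False by simp
    qed
    then show ?thesis using j b by simp
  qed
  then show ?thesis using j by blast
qed

section \<open>Degenerate kernels: orthogonality and second moments\<close>

context iid_seq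
begin

lemma abs_integral_le:
  fixes f :: "(nat \<Rightarrow> 'a) \<Rightarrow> real"
  assumes "\<And>w. \<bar>f w\<bar> \<le> C"
  shows "\<bar>\<integral>w. f w \<partial>P\<bar> \<le> C"
proof (cases "integrable P f")
  case True
  have "\<bar>\<integral>w. f w \<partial>P\<bar> \<le> (\<integral>w. \<bar>f w\<bar> \<partial>P)"
    by (rule integral_abs_bound)
  also have "\<dots> \<le> (\<integral>w. C \<partial>P)"
    using True assms by (intro integral_mono) auto
  finally show ?thesis by (simp add: seq.prob_space)
next
  case False
  \<comment> \<open>A non-integrable function has integral 0 by default, and \<open>C\<close> is
    nonnegative because it bounds an absolute value.\<close>
  then show ?thesis
    using order_trans[OF abs_ge_zero assms] by (simp add: not_integrable_integral_eq)
qed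

lemma integrable_bounded:
  fixes f :: "(nat \<Rightarrow> 'a) \<Rightarrow> real"
  assumes "f \<in> borel_measurable P" "\<And>w. \<bar>f w\<bar> \<le> C"
  shows "integrable P f"
  using assms by (intro seq.integrable_const_bound[where B = C]) auto

text \<open>Without overlap the tuples share at most the index \<open>i j\<close>. Injectivity of
  \<open>i\<close> ensures that freezing this coordinate freezes exactly the argument
  \<open>j\<close> of \<open>H\<close>, and then \<open>H\<close> averages to zero over its other
  arguments.\<close>

lemma degenerate_orthogonal:
  fixes H :: "(nat \<Rightarrow> 'a) \<Rightarrow> real"
  assumes H: "H \<in> borel_measurable P" and HC: "\<And>w. \<bar>H w\<bar> \<le> C" and dep: "depends_on {1..k} H"
    and zero: "\<And>j x. j \<in> {1..k} \<Longrightarrow> x \<in> space M \<Longrightarrow> (\<integral>w. H (w(j := x)) \<partial>P) = 0"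
    and "k \<ge> 1" and i: "inj_on i {1..k}" and no: "\<not> overlapping k i i'"
  shows "(\<integral>w. H (\<lambda>a. w (i a)) * H (\<lambda>a. w (i' a)) \<partial>P) = 0"
proof -
  obtain j where j: "j \<in> {1..k}" "i ` {1..k} \<inter> i' ` {1..k} \<subseteq> {i j}"
    using not_overlapping_imp[OF no \<open>k \<ge> 1\<close>] by blast
  note m = measurable_compose[OF measurable_reindex H]
  show ?thesis
  proof (rule integral_mult_shared)
    show "(\<lambda>w. H (\<lambda>a. w (i a))) \<in> borel_measurable P" "(\<lambda>w. H (\<lambda>a. w (i' a))) \<in> borel_measurable P"
      by (rule m)+
    show "\<bar>H (\<lambda>a. w (i a))\<bar> \<le> C" "\<bar>H (\<lambda>a. w (i' a))\<bar> \<le> C" for w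
      by (rule HC)+
    show "depends_on (i ` {1..k}) (\<lambda>w. H (\<lambda>a. w (i a)))" "depends_on (i' ` {1..k}) (\<lambda>w. H (\<lambda>a. w (i' a)))"
      by (rule depends_on_reindex[OF dep])+
    show "i ` {1..k} \<inter> i' ` {1..k} \<subseteq> {i j}" by (rule j(2))
    fix x assume x: "x \<in> space M"
    have "(\<integral>w. H (\<lambda>a. (w(i j := x)) (i a)) \<partial>P) = (\<integral>w. H ((\<lambda>a. w (i a))(j := x)) \<partial>P)"
    proof (rule Bochner_Integration.integral_cong[OF refl], rule depends_onD[OF dep])
      fix w :: "nat \<Rightarrow> 'a" and b assume b: "b \<in> {1..k}"
      have "i b = i j \<longleftrightarrow> b = j" using i b j(1) by (rule inj_on_eq_iff)
      then show "(w(i j := x)) (i b) = ((\<lambda>a. w (i a))(j := x)) b" by simp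
    qed
    also have "\<dots> = (\<integral>w. H (w(j := x)) \<partial>P)"
    proof (rule integral_reindex[where f = "\<lambda>w. H (w(j := x))"])
      show "(\<lambda>w. H (w(j := x))) \<in> borel_measurable P"
        by (rule measurable_compose[OF measurable_upd1[OF x] H])
      show "depends_on ({1..k} - {j}) (\<lambda>w. H (w(j := x)))"
        by (rule depends_on_upd[OF dep])
      show "inj_on i ({1..k} - {j})"
        using i by (rule inj_on_subset) auto
    qed
    finally show "(\<integral>w. H (\<lambda>a. (w(i j := x)) (i a)) \<partial>P) = 0"
      using zero[OF j(1) x] by simp
  qed
qed

text \<open>Expand the square over injective tuples: only overlapping pairs survive, at most k ^ 4 *
  n ^ (2 k - 2) of them, each contributing at most C ^ 2. The non-injective tuples are so few that
  their sum is bounded pointwise, with a square of the same order. The inequality (a + b) ^ 2 \<le>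
  2 a ^ 2 + 2 b ^ 2 joins the parts and gives the factor 4.\<close>

lemma second_moment_degenerate:
  fixes H :: "(nat \<Rightarrow> 'a) \<Rightarrow> real"
  assumes H: "H \<in> borel_measurable P" and HC: "\<And>w. \<bar>H w\<bar> \<le> C" and dep: "depends_on {1..k} H"
    and zero: "\<And>j x. j \<in> {1..k} \<Longrightarrow> x \<in> space M \<Longrightarrow> (\<integral>w. H (w(j := x)) \<partial>P) = 0"
    and k: "k \<ge> 1"
  shows "(\<integral>w. (\<Sum>i\<in>tuples k n. H (\<lambda>a. w (i a)))\<^sup>2 \<partial>P) \<le> 4 * C\<^sup>2 * real k ^ 4 * real n ^ (2 * k - 2)"
proof -
  note [measurable] = measurable_compose[OF measurable_reindex H]
  have C0: "C \<ge> 0" using order_trans[OF abs_ge_zero HC] by blast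
  define I where "I = {i \<in> tuples k n. inj_on i {1..k}}"
  define J where "J = {i \<in> tuples k n. \<not> inj_on i {1..k}}"
  have fin: "finite I" "finite J" and IJ: "tuples k n = I \<union> J" "I \<inter> J = {}"
    unfolding I_def J_def by (rule finite_subset[OF _ finite_tuples], blast | blast)+
  define S where "S w = (\<Sum>i\<in>I. H (\<lambda>a. w (i a)))" for w
  define S' where "S' w = (\<Sum>i\<in>J. H (\<lambda>a. w (i a)))" for w
  have [measurable]: "S \<in> borel_measurable P" "S' \<in> borel_measurable P"
    by (auto simp: S_def[abs_def] S'_def[abs_def])
  have HH: "\<bar>H x * H y\<bar> \<le> C\<^sup>2" for x y
    unfolding abs_mult power2_eq_square by (intro mult_mono HC C0) auto
  have int: "integrable P (\<lambda>w. H (\<lambda>a. w (i a)) * H (\<lambda>a. w (i' a)))" for i i'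
    by (rule integrable_bounded[OF _ HH]) measurable
  have S2: "(S w)\<^sup>2 = (\<Sum>(i, i')\<in>I \<times> I. H (\<lambda>a. w (i a)) * H (\<lambda>a. w (i' a)))" for w
    unfolding S_def power2_eq_square sum_product sum.cartesian_product ..
  have intS2: "integrable P (\<lambda>w. (S w)\<^sup>2)"
    unfolding S2 by (intro Bochner_Integration.integrable_sum) (auto simp: int)
  have "(\<integral>w. (S w)\<^sup>2 \<partial>P) = (\<Sum>(i, i')\<in>I \<times> I. \<integral>w. H (\<lambda>a. w (i a)) * H (\<lambda>a. w (i' a)) \<partial>P)"
    unfolding S2 by (subst Bochner_Integration.integral_sum) (auto simp: int case_prod_unfold)
  also have "\<dots> \<le> (\<Sum>(i, i')\<in>I \<times> I. if overlapping k i i' then C\<^sup>2 else 0)"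
  proof (intro sum_mono, clarify)
    fix i i' assume "i \<in> I" "i' \<in> I"
    show "(\<integral>w. H (\<lambda>a. w (i a)) * H (\<lambda>a. w (i' a)) \<partial>P) \<le> (if overlapping k i i' then C\<^sup>2 else 0)"
      using abs_integral_le[OF HH, of "\<lambda>w a. w (i a)" "\<lambda>w a. w (i' a)"] \<open>i \<in> I\<close>
        degenerate_orthogonal[OF H HC dep zero k, of i i'] by (auto simp: I_def)
  qed
  also have "\<dots> = C\<^sup>2 * card {(i, i') \<in> I \<times> I. overlapping k i i'}"
  proof -
    have "(\<Sum>(i, i')\<in>I \<times> I. if overlapping k i i' then C\<^sup>2 else 0) =
        (\<Sum>p\<in>I \<times> I. if overlapping k (fst p) (snd p) then C\<^sup>2 else 0)"
      by (simp add: case_prod_unfold)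
    also have "\<dots> = (\<Sum>p\<in>{p \<in> I \<times> I. overlapping k (fst p) (snd p)}. C\<^sup>2)"
      by (rule sum.inter_filter[symmetric]) (use fin in simp)
    finally show ?thesis
      by (simp only: case_prod_unfold prod.collapse sum_constant mult.commute)
  qed
  also have "real (card {(i, i') \<in> I \<times> I. overlapping k i i'}) \<le> real (k ^ 4 * n ^ (2 * k - 2))"
  proof -
    have "card {(i, i') \<in> I \<times> I. overlapping k i i'}
        \<le> card {(i, i') \<in> tuples k n \<times> tuples k n. overlapping k i i'}"
      by (intro card_mono finite_subset[OF _ finite_cartesian_product[OF finite_tuples finite_tuples]])
         (auto simp: I_def)
    with card_overlapping_tuples[of k n] show ?thesis by linarith
  qed
  finally have 1: "(\<integral>w. (S w)\<^sup>2 \<partial>P) \<le> C\<^sup>2 * real k ^ 4 * real n ^ (2 * k - 2)"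
    by (simp add: mult_left_mono)
  have "\<bar>S' w\<bar> \<le> C * real k ^ 2 * real n ^ (k - 1)" for w
  proof -
    have "\<bar>S' w\<bar> \<le> (\<Sum>i\<in>J. C)"
      unfolding S'_def by (rule order_trans[OF sum_abs sum_mono]) (rule HC)
    also have "\<dots> = C * real (card J)" by simp
    also have "\<dots> \<le> C * real (k ^ 2 * n ^ (k - 1))"
      using card_non_injective_tuples[of k n] C0 unfolding J_def
      by (intro mult_left_mono of_nat_mono)
    finally show ?thesis by simp
  qed
  then have "\<bar>S' w\<bar>\<^sup>2 \<le> (C * real k ^ 2 * real n ^ (k - 1))\<^sup>2" for w
    by (intro power_mono) auto
  then have S'2: "(S' w)\<^sup>2 \<le> C\<^sup>2 * real k ^ 4 * real n ^ (2 * k - 2)" for w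
    by (simp add: power_mult_distrib power_mult[symmetric] mult.commute right_diff_distrib')
  have "(\<integral>w. (\<Sum>i\<in>tuples k n. H (\<lambda>a. w (i a)))\<^sup>2 \<partial>P) = (\<integral>w. (S w + S' w)\<^sup>2 \<partial>P)"
    unfolding S_def S'_def IJ(1) using fin IJ(2) by (simp add: sum.union_disjoint)
  also have "\<dots> \<le> (\<integral>w. 2 * (S w)\<^sup>2 + 2 * (C\<^sup>2 * real k ^ 4 * real n ^ (2 * k - 2)) \<partial>P)"
  proof (rule integral_mono')
    show "integrable P (\<lambda>w. 2 * (S w)\<^sup>2 + 2 * (C\<^sup>2 * real k ^ 4 * real n ^ (2 * k - 2)))"
      using intS2 by auto
    fix w
    have "(S w + S' w)\<^sup>2 \<le> 2 * (S w)\<^sup>2 + 2 * (S' w)\<^sup>2"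
      using zero_le_power2[of "S w - S' w"] by (simp add: power2_eq_square algebra_simps)
    with S'2[of w] show "(S w + S' w)\<^sup>2 \<le> 2 * (S w)\<^sup>2 + 2 * (C\<^sup>2 * real k ^ 4 * real n ^ (2 * k - 2))"
      by linarith
  qed auto
  also have "\<dots> \<le> 4 * C\<^sup>2 * real k ^ 4 * real n ^ (2 * k - 2)"
    using 1 intS2 by (simp add: seq.prob_space)
  finally show ?thesis .
qed

end

section \<open>Normal limits\<close>

lemma real_distribution_centered_normal: "s \<ge> 0 \<Longrightarrow> real_distribution (centered_normal s)"
proof (cases "s = 0")
  case True
  interpret prob_space "return borel (0 :: real)" by (rule prob_space_return) simp
  show ?thesis
    unfolding centered_normal_def using True
    by (auto simp: real_distribution_def real_distribution_axioms_def prob_space_axioms)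
next
  case False
  assume "s \<ge> 0"
  then show ?thesis
    using False prob_space_normal_density[of s 0]
    by (auto simp: centered_normal_def real_distribution_def real_distribution_axioms_def)
qed

text \<open>For positive s this is scaling from the standard normal law. The same formula gives 1 at
  s = 0, the characteristic function of the point mass, so the continuity theorem can be applied
  without separating the degenerate limit.\<close>

lemma char_centered_normal:
  assumes "s \<ge> 0"
  shows "char (centered_normal s) t = of_real (exp (- ((s * t)\<^sup>2) / 2))"
proof (cases "s = 0")
  case True
  then show ?thesis
    by (simp add: centered_normal_def char_def integral_return)
next
  case False
  with assms have s: "s > 0" by simp
  define N where "N = density lborel (\<lambda>x. ennreal (normal_density 0 s x))"
  interpret prob_space N
    unfolding N_def by (rule prob_space_normal_density[OF s])
  have [measurable_cong]: "sets N = sets borel" by (simp add: N_def)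
  have "distributed N lborel (\<lambda>x. x) (normal_density 0 s)"
    unfolding distributed_def by (auto simp: N_def distr_id2 intro!: measurable_ident_sets)
  then have "distributed N lborel (\<lambda>x. (x - 0) / s) std_normal_density"
    by (subst (asm) normal_standard_normal_convert[OF s])
  then have eq: "distr N lborel (\<lambda>x. x / s) = std_normal_distribution"
    by (simp add: distributed_def)
  have "char std_normal_distribution (s * t) = (\<integral>y. iexp (s * t * y) \<partial>distr N lborel (\<lambda>x. x / s))"
    by (simp add: eq char_def)
  also have "\<dots> = (\<integral>x. iexp (s * t * (x / s)) \<partial>N)"
    by (subst integral_distr) auto
  also have "\<dots> = char (centered_normal s) t"
    using s by (simp add: centered_normal_def char_def N_def)
  finally show ?thesis
    by (simp add: char_std_normal_distribution)
qed

lemma norm_iexp_diff_le: "cmod (iexp x - iexp y) \<le> \<bar>x - y\<bar>"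
proof -
  have "iexp x - iexp y = iexp y * (iexp (x - y) - 1)"
    by (simp add: algebra_simps exp_add[symmetric])
  then have "cmod (iexp x - iexp y) = cmod (iexp (x - y) - 1)"
    by (simp add: norm_mult)
  also have "\<dots> = 2 * \<bar>sin ((x - y) / 2)\<bar>"
    by (rule dist_exp_i_1)
  also have "\<dots> \<le> \<bar>x - y\<bar>"
    using abs_sin_x_le_abs_x[of "(x - y) / 2"] by simp
  finally show ?thesis .
qed

section \<open>Stability of normal limits under small perturbations\<close>

context prob_space
begin

lemma char_distr_eq:
  assumes [measurable]: "X \<in> borel_measurable M"
  shows "char (distr M borel X) t = (\<integral>w. iexp (t * X w) \<partial>M)"
  unfolding char_def by (subst integral_distr) auto

text \<open>A quantitative Slutsky estimate: since \<open>iexp\<close> is Lipschitz with constant 1,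
  a perturbation that is small in mean changes the characteristic function little at each fixed
  t.\<close>

lemma norm_char_add_diff_le:
  assumes [measurable]: "X \<in> borel_measurable M" "Y \<in> borel_measurable M" and Y: "integrable M Y"
  shows "cmod (char (distr M borel (\<lambda>w. X w + Y w)) t - char (distr M borel X) t)
      \<le> \<bar>t\<bar> * (\<integral>w. \<bar>Y w\<bar> \<partial>M)"
proof -
  have int: "integrable M (\<lambda>w. iexp (t * Z w))" if [measurable]: "Z \<in> borel_measurable M" for Z
    by (rule integrable_const_bound[where B = 1]) auto
  have "char (distr M borel (\<lambda>w. X w + Y w)) t - char (distr M borel X) t =
      (\<integral>w. iexp (t * (X w + Y w)) - iexp (t * X w) \<partial>M)"
  proof -
    have m: "(\<lambda>w. X w + Y w) \<in> borel_measurable M" by measurable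
    show ?thesis
      unfolding char_distr_eq[OF m] char_distr_eq[OF assms(1)]
      by (rule Bochner_Integration.integral_diff[OF int[OF m] int[OF assms(1)], symmetric])
  qed
  also have "cmod \<dots> \<le> (\<integral>w. cmod (iexp (t * (X w + Y w)) - iexp (t * X w)) \<partial>M)"
    by (rule integral_norm_bound)
  also have "\<dots> \<le> (\<integral>w. \<bar>t\<bar> * \<bar>Y w\<bar> \<partial>M)"
  proof (rule integral_mono')
    show "integrable M (\<lambda>w. \<bar>t\<bar> * \<bar>Y w\<bar>)" using Y by auto
    fix w
    have "cmod (iexp (t * (X w + Y w)) - iexp (t * X w)) \<le> \<bar>t * (X w + Y w) - t * X w\<bar>"
      by (rule norm_iexp_diff_le)
    also have "\<dots> = \<bar>t\<bar> * \<bar>Y w\<bar>"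
      by (simp add: abs_mult[symmetric] algebra_simps)
    finally show "cmod (iexp (t * (X w + Y w)) - iexp (t * X w)) \<le> \<bar>t\<bar> * \<bar>Y w\<bar>" .
  qed auto
  finally show ?thesis by simp
qed

text \<open>\<open>B\<close> has second moment O(1 / n), so its mean absolute value and the cross
  term with \<open>A\<close> are O(1 / sqrt n). Both estimates use elementary weighted inequalities
  between products and squares, with weight sqrt n, in the role of Cauchy-Schwarz. Convergence of
  the variance and convergence in law come out with the same s.\<close>

lemma normal_limit_perturbation:
  fixes A B :: "nat \<Rightarrow> 'a \<Rightarrow> real"
  assumes [measurable]: "\<And>n. A n \<in> borel_measurable M" "\<And>n. B n \<in> borel_measurable M"
    and A2: "\<And>n. integrable M (\<lambda>w. (A n w)\<^sup>2)" and B2: "\<And>n. integrable M (\<lambda>w. (B n w)\<^sup>2)"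
    and s: "s \<ge> 0"
    and EA: "\<And>n. n \<ge> 1 \<Longrightarrow> expectation (\<lambda>w. (A n w)\<^sup>2) = s\<^sup>2"
    and EB: "\<And>n. n \<ge> 1 \<Longrightarrow> expectation (\<lambda>w. (B n w)\<^sup>2) \<le> K / real n"
    and char: "\<And>t. (\<lambda>n. char (distr M borel (A n)) t) \<longlonglongrightarrow> of_real (exp (- ((s * t)\<^sup>2) / 2))"
  shows "(\<lambda>n. expectation (\<lambda>w. (A n w + B n w)\<^sup>2)) \<longlonglongrightarrow> s\<^sup>2" (is ?var)
    and "weak_conv_m (\<lambda>n. distr M borel (\<lambda>w. A n w + B n w)) (centered_normal s)" (is ?weak)
proof -
  have A1: "integrable M (A n)" and B1: "integrable M (B n)" for n
    by (rule square_integrable_imp_integrable, use A2 B2 in auto)+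
  have AB: "integrable M (\<lambda>w. A n w * B n w)" for n
  proof (rule Bochner_Integration.integrable_bound[OF Bochner_Integration.integrable_add[OF A2[of n] B2[of n]]])
    have "\<bar>a * b\<bar> \<le> a\<^sup>2 + b\<^sup>2" for a b :: real
      using zero_le_power2[of "\<bar>a\<bar> - \<bar>b\<bar>"] abs_ge_zero[of "a * b"]
      unfolding power2_diff power2_abs abs_mult by linarith
    then show "AE w in M. norm (A n w * B n w) \<le> norm ((A n w)\<^sup>2 + (B n w)\<^sup>2)"
      by (intro AE_I2) (simp add: abs_of_nonneg)
  qed simp
  have EabsB: "expectation (\<lambda>w. \<bar>B n w\<bar>) \<le> (1 + K) / sqrt (real n)" if n: "n \<ge> 1" for n
  proof -
    have r: "sqrt (real n) > 0" using n by simp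
    have "expectation (\<lambda>w. \<bar>B n w\<bar>) \<le> expectation (\<lambda>w. 1 / sqrt n + sqrt n * (B n w)\<^sup>2)"
    proof (rule integral_mono)
      fix w
      \<comment> \<open>The extra linear term leaves sqrt n * |B| with coefficient -1 after
        expansion; division by sqrt n then yields the bound.\<close>
      have "0 \<le> (1 - sqrt n * \<bar>B n w\<bar>)\<^sup>2 + sqrt n * \<bar>B n w\<bar>" using r by simp
      also have "\<dots> = 1 - sqrt n * \<bar>B n w\<bar> + sqrt n * (sqrt n * (B n w)\<^sup>2)"
        by (simp add: power2_eq_square algebra_simps abs_mult_self)
      finally have "sqrt n * \<bar>B n w\<bar> \<le> 1 + sqrt n * (sqrt n * (B n w)\<^sup>2)" by simp
      then show "\<bar>B n w\<bar> \<le> 1 / sqrt n + sqrt n * (B n w)\<^sup>2"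
        using r by (simp add: field_simps)
    qed (use B1 B2 in auto)
    also have "\<dots> = 1 / sqrt n + sqrt n * expectation (\<lambda>w. (B n w)\<^sup>2)"
      using B2 by (simp add: prob_space)
    also have "\<dots> \<le> 1 / sqrt n + sqrt n * (K / n)"
      using EB[OF n] r by (intro add_left_mono mult_left_mono) auto
    also have "\<dots> = (1 + K) / sqrt n"
      using r n by (simp add: field_simps)
    finally show ?thesis .
  qed
  have lim0: "(\<lambda>n. c / sqrt (real n)) \<longlonglongrightarrow> 0" for c
    by real_asymp
  have limK: "(\<lambda>n. c / real n) \<longlonglongrightarrow> 0" for c
    by real_asymp
  show ?var
  proof -
    have eq: "expectation (\<lambda>w. (A n w + B n w)\<^sup>2) =
        expectation (\<lambda>w. (A n w)\<^sup>2) + 2 * expectation (\<lambda>w. A n w * B n w) + expectation (\<lambda>w. (B n w)\<^sup>2)" for n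
    proof -
      have "expectation (\<lambda>w. (A n w + B n w)\<^sup>2) =
          expectation (\<lambda>w. (A n w)\<^sup>2 + 2 * (A n w * B n w) + (B n w)\<^sup>2)"
        by (simp add: power2_sum algebra_simps)
      then show ?thesis using A2 B2 AB by simp
    qed
    have bound: "norm (expectation (\<lambda>w. (A n w + B n w)\<^sup>2) - s\<^sup>2) \<le> (s\<^sup>2 + K) / sqrt n + K / n"
      if n: "n \<ge> 1" for n
    proof -
      have r: "sqrt (real n) > 0" using n by simp
      have "\<bar>2 * expectation (\<lambda>w. A n w * B n w)\<bar> = \<bar>expectation (\<lambda>w. 2 * (A n w * B n w))\<bar>"
        by simp
      also have "\<dots> \<le> expectation (\<lambda>w. \<bar>2 * (A n w * B n w)\<bar>)"
        by (rule integral_abs_bound)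
      also have "\<dots> \<le> expectation (\<lambda>w. (A n w)\<^sup>2 / sqrt n + sqrt n * (B n w)\<^sup>2)"
      proof (rule integral_mono)
        fix w
        \<comment> \<open>The weight sqrt n balances the two squares: E A ^ 2 / sqrt n and sqrt n *
          E B ^ 2 are both O(1 / sqrt n).\<close>
        have "0 \<le> (\<bar>A n w\<bar> - sqrt n * \<bar>B n w\<bar>)\<^sup>2" by simp
        also have "\<dots> = (A n w)\<^sup>2 + sqrt n * (sqrt n * (B n w)\<^sup>2) - sqrt n * \<bar>2 * (A n w * B n w)\<bar>"
          by (simp add: power2_diff power_mult_distrib abs_mult algebra_simps)
        finally have "sqrt n * \<bar>2 * (A n w * B n w)\<bar> \<le> (A n w)\<^sup>2 + sqrt n * (sqrt n * (B n w)\<^sup>2)" by simp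
        then show "\<bar>2 * (A n w * B n w)\<bar> \<le> (A n w)\<^sup>2 / sqrt n + sqrt n * (B n w)\<^sup>2"
          using r by (simp add: field_simps)
      qed (use A2 B2 AB in auto)
      also have "\<dots> = s\<^sup>2 / sqrt n + sqrt n * expectation (\<lambda>w. (B n w)\<^sup>2)"
        using A2 B2 by (simp add: EA[OF n])
      also have "\<dots> \<le> s\<^sup>2 / sqrt n + sqrt n * (K / n)"
        using EB[OF n] r by (intro add_left_mono mult_left_mono) auto
      also have "\<dots> = (s\<^sup>2 + K) / sqrt n"
        using r n by (simp add: field_simps)
      finally have "\<bar>2 * expectation (\<lambda>w. A n w * B n w)\<bar> \<le> (s\<^sup>2 + K) / sqrt n" .
      moreover have "expectation (\<lambda>w. (B n w)\<^sup>2) \<ge> 0" by simp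
      ultimately show ?thesis
        using EB[OF n] unfolding eq EA[OF n] real_norm_def by linarith
    qed
    have "(\<lambda>n. expectation (\<lambda>w. (A n w + B n w)\<^sup>2) - s\<^sup>2) \<longlonglongrightarrow> 0"
    proof (rule Lim_null_comparison)
      show "\<forall>\<^sub>F n in sequentially. norm (expectation (\<lambda>w. (A n w + B n w)\<^sup>2) - s\<^sup>2)
          \<le> (s\<^sup>2 + K) / sqrt n + K / n"
        using eventually_ge_at_top[of 1] by eventually_elim (rule bound)
      show "(\<lambda>n. (s\<^sup>2 + K) / sqrt n + K / n) \<longlonglongrightarrow> 0"
        using tendsto_add[OF lim0 limK] by simp
    qed
    then show ?thesis by (simp add: LIM_zero_iff)
  qed
  show ?weak
  proof (rule levy_continuity)
    show "real_distribution (centered_normal s)"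
      by (rule real_distribution_centered_normal[OF s])
    fix t
    have "(\<lambda>n. char (distr M borel (\<lambda>w. A n w + B n w)) t - char (distr M borel (A n)) t) \<longlonglongrightarrow> 0"
    proof (rule Lim_null_comparison)
      show "\<forall>\<^sub>F n in sequentially. cmod (char (distr M borel (\<lambda>w. A n w + B n w)) t
          - char (distr M borel (A n)) t) \<le> \<bar>t\<bar> * ((1 + K) / sqrt (real n))"
        using eventually_ge_at_top[of 1]
      proof eventually_elim
        case (elim n)
        have "cmod (char (distr M borel (\<lambda>w. A n w + B n w)) t - char (distr M borel (A n)) t)
            \<le> \<bar>t\<bar> * expectation (\<lambda>w. \<bar>B n w\<bar>)"
          by (rule norm_char_add_diff_le) (use B1 in auto)
        also have "\<dots> \<le> \<bar>t\<bar> * ((1 + K) / sqrt (real n))"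
          by (intro mult_left_mono EabsB elim) auto
        finally show ?case .
      qed
      show "(\<lambda>n. \<bar>t\<bar> * ((1 + K) / sqrt (real n))) \<longlonglongrightarrow> 0"
        using tendsto_mult_right_zero[OF lim0] .
    qed
    from tendsto_add[OF this char[of t]]
    show "(\<lambda>n. char (distr M borel (\<lambda>w. A n w + B n w)) t) \<longlonglongrightarrow> char (centered_normal s) t"
      by (simp add: char_centered_normal[OF s])
  qed auto
qed

end

section \<open>Hoeffding decomposition and the limit theorem for sums over index tuples\<close>

context iid_seq
begin

lemma normalized_sum_second_moment:
  fixes G :: "'a \<Rightarrow> real"
  assumes G [measurable]: "G \<in> borel_measurable M" and GC: "\<And>x. \<bar>G x\<bar> \<le> C"
    and G0: "(\<integral>x. G x \<partial>M) = 0" and n: "n \<ge> 1"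
  shows "(\<integral>w. ((\<Sum>v=1..n. G (w v)) / sqrt n)\<^sup>2 \<partial>P) = (\<integral>x. (G x)\<^sup>2 \<partial>M)"
proof -
  have eG: "(\<integral>w. g (w v) \<partial>P) = (\<integral>x. g x \<partial>M)" if [measurable]: "g \<in> borel_measurable M"
    for g :: "'a \<Rightarrow> real" and v
    by (subst (2) distr_coord[symmetric, of v], subst integral_distr) auto
  have GG: "\<bar>G x * G y\<bar> \<le> C * C" for x y
    unfolding abs_mult by (intro mult_mono GC) (auto intro: order_trans[OF abs_ge_zero GC])
  have cov: "(\<integral>w. G (w u) * G (w v) \<partial>P) = (if u = v then \<integral>x. (G x)\<^sup>2 \<partial>M else 0)" for u v
  proof (cases "u = v")
    case True
    have "(\<lambda>x. (G x)\<^sup>2) \<in> borel_measurable M" by measurable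
    from eG[OF this, of v] True show ?thesis by (simp add: power2_eq_square)
  next
    case False
    have "(\<integral>w. G (w u) * G (w v) \<partial>P) = (\<integral>w. G (w u) \<partial>P) * (\<integral>w. G (w v) \<partial>P)"
      by (rule integral_mult_disjoint[where I = "{u}" and J = "{v}" and C = C and D = C])
         (use False GC in \<open>auto simp: depends_on_def\<close>)
    with False show ?thesis by (simp add: eG[OF G] G0)
  qed
  have int: "integrable P (\<lambda>w. G (w u) * G (w v))" for u v
    by (rule integrable_bounded[OF _ GG]) measurable
  have "(\<integral>w. ((\<Sum>v=1..n. G (w v)) / sqrt n)\<^sup>2 \<partial>P) =
      (\<integral>w. (\<Sum>u=1..n. \<Sum>v=1..n. G (w u) * G (w v)) / n \<partial>P)"
    by (simp add: power_divide power2_eq_square[of "sum _ _"] sum_product)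
  also have "\<dots> = (\<Sum>u=1..n. \<Sum>v=1..n. if u = v then \<integral>x. (G x)\<^sup>2 \<partial>M else 0) / n"
    by (subst integral_divide_zero, subst Bochner_Integration.integral_sum)
       (auto intro!: Bochner_Integration.integrable_sum int sum.cong simp: Bochner_Integration.integral_sum int cov)
  also have "\<dots> = (\<integral>x. (G x)\<^sup>2 \<partial>M)"
    using n by (simp add: sum.delta)
  finally show ?thesis .
qed

text \<open>For s = 0 the summands vanish almost surely and every characteristic function is 1.
  Otherwise the classical theorem, which divides by the standard deviation, applies.\<close>

lemma normalized_sum_char_tendsto:
  fixes G :: "'a \<Rightarrow> real"
  assumes G [measurable]: "G \<in> borel_measurable M" and GC: "\<And>x. \<bar>G x\<bar> \<le> C"
    and G0: "(\<integral>x. G x \<partial>M) = 0" and s: "s \<ge> 0" "s\<^sup>2 = (\<integral>x. (G x)\<^sup>2 \<partial>M)"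
  shows "(\<lambda>n. char (distr P borel (\<lambda>w. (\<Sum>v=1..n. G (w v)) / sqrt n)) t)
      \<longlonglongrightarrow> of_real (exp (- ((s * t)\<^sup>2) / 2))"
proof (cases "s = 0")
  case True
  have int: "integrable M (\<lambda>x. (G x)\<^sup>2)"
  proof (rule integrable_const_bound[where B = "C\<^sup>2"])
    have "(G x)\<^sup>2 \<le> C\<^sup>2" for x
      using power_mono[OF GC abs_ge_zero, of x 2] by simp
    then show "AE x in M. norm ((G x)\<^sup>2) \<le> C\<^sup>2" by auto
  qed measurable
  have "AE x in M. (G x)\<^sup>2 = 0"
    using integral_nonneg_eq_0_iff_AE[OF int] s True by simp
  then have "AE x in distr P M (\<lambda>w. w v). G x = 0" for v
    unfolding distr_coord by simp
  then have "AE w in P. G (w v) = 0" for v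
    by (subst (asm) AE_distr_iff) auto
  then have *: "AE w in P. \<forall>v. G (w v) = 0"
    by (simp add: AE_all_countable)
  have "char (distr P borel (\<lambda>w. (\<Sum>v=1..n. G (w v)) / sqrt n)) t = 1" for n
  proof -
    have "char (distr P borel (\<lambda>w. (\<Sum>v=1..n. G (w v)) / sqrt n)) t =
        (\<integral>w. iexp (t * ((\<Sum>v=1..n. G (w v)) / sqrt n)) \<partial>P)"
      by (rule seq.char_distr_eq) measurable
    also have "\<dots> = (\<integral>w. 1 \<partial>P)"
      by (rule integral_cong_AE) (measurable, use * in \<open>auto elim!: eventually_mono\<close>)
    finally show ?thesis by (simp add: seq.prob_space)
  qed
  then show ?thesis using True by simp
next
  case False
  with s(1) have s0: "s > 0" by simp
  \<comment> \<open>The central limit theorem sums over i < n, the tuples use the indices 1 to n;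
    hence the shift.\<close>
  define X where "X v w = G (w (Suc v))" for v :: nat and w
  have Xm [measurable]: "X v \<in> borel_measurable P" for v
    unfolding X_def[abs_def] by measurable
  have dX: "distr P borel (X v) = distr M borel G" for v
    by (subst distr_coord[symmetric, of "Suc v"], subst distr_distr) (auto simp: o_def X_def[abs_def])
  have eX: "(\<integral>w. g (X v w) \<partial>P) = (\<integral>x. g (G x) \<partial>M)" if [measurable]: "g \<in> borel_measurable borel"
    for g :: "real \<Rightarrow> real" and v
  proof -
    have "(\<integral>w. g (X v w) \<partial>P) = (\<integral>y. g y \<partial>distr P borel (X v))"
      by (subst integral_distr) auto
    also have "\<dots> = (\<integral>x. g (G x) \<partial>M)"
      unfolding dX by (subst integral_distr) auto
    finally show ?thesis .
  qed
  have X0: "(\<integral>w. X v w \<partial>P) = 0" for v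
    using eX[of "\<lambda>x. x" v] G0 by simp
  have "seq.indep_vars (\<lambda>_. borel) X UNIV"
    unfolding X_def[abs_def] by (rule seq.indep_vars_compose2[OF indep_coords_reindex]) auto
  then have "weak_conv_m (\<lambda>n. distr P borel (\<lambda>w. (\<Sum>i<n. X i w) / sqrt (n * s\<^sup>2))) std_normal_distribution"
  proof (rule seq.central_limit_theorem_zero_mean[OF _ X0 s0])
    have "(X v w)\<^sup>2 \<le> C\<^sup>2" for v w
      using power_mono[OF GC abs_ge_zero, of "w (Suc v)" 2] by (simp add: X_def)
    then show "integrable P (\<lambda>x. (X n x)\<^sup>2)" for n
      by (intro seq.integrable_const_bound[where B = "C\<^sup>2"]) auto
    show "seq.variance (X n) = s\<^sup>2" for n
      using eX[of "\<lambda>x. x\<^sup>2" n] s(2) by (simp add: X0)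
    show "distr P borel (X n) = distr M borel G" for n by (rule dX)
  qed
  \<comment> \<open>Evaluating at s * t cancels the factor s in the normalisation.\<close>
  then have "(\<lambda>n. char (distr P borel (\<lambda>w. (\<Sum>i<n. X i w) / sqrt (n * s\<^sup>2))) (s * t))
      \<longlonglongrightarrow> char std_normal_distribution (s * t)"
    by (intro levy_continuity1) (auto intro: real_dist_normal_dist)
  moreover have "char (distr P borel (\<lambda>w. (\<Sum>i<n. X i w) / sqrt (n * s\<^sup>2))) (s * t) =
      char (distr P borel (\<lambda>w. (\<Sum>v=1..n. G (w v)) / sqrt n)) t" for n
  proof -
    have "(\<Sum>i<n. X i w) = (\<Sum>v=1..n. G (w v))" for w
      unfolding X_def by (rule sum.reindex_bij_witness[of _ "\<lambda>v. v - 1" Suc]) auto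
    then have "s * t * ((\<Sum>i<n. X i w) / sqrt (n * s\<^sup>2)) = t * ((\<Sum>v=1..n. G (w v)) / sqrt n)" for w
      using s0 by (simp add: real_sqrt_mult)
    moreover have "char (distr P borel (\<lambda>w. (\<Sum>i<n. X i w) / sqrt (n * s\<^sup>2))) (s * t) =
        (\<integral>w. iexp (s * t * ((\<Sum>i<n. X i w) / sqrt (n * s\<^sup>2))) \<partial>P)"
      by (rule seq.char_distr_eq) measurable
    moreover have "char (distr P borel (\<lambda>w. (\<Sum>v=1..n. G (w v)) / sqrt n)) t =
        (\<integral>w. iexp (t * ((\<Sum>v=1..n. G (w v)) / sqrt n)) \<partial>P)"
      by (rule seq.char_distr_eq) measurable
    ultimately show ?thesis by presburger
  qed
  ultimately show ?thesis
    by (simp add: char_std_normal_distribution)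
qed

text \<open>\<open>g j\<close> is the centred conditional expectation of the kernel given its j-th
  argument. The kernel is not assumed symmetric, so the k projections differ; each label visits
  position j in n ^ (k - 1) tuples, and \<open>G\<close> adds all of them up. What remains,
  \<open>H\<close>, has mean zero once any single argument is frozen, and is thus
  degenerate.\<close>

lemma hoeffding_decomposition:
  fixes h :: "(nat \<Rightarrow> 'a) \<Rightarrow> real"
  assumes h: "h \<in> borel_measurable P" and h1: "\<And>w. \<bar>h w\<bar> \<le> 1" and dep: "depends_on {1..k} h"
    and k: "k \<ge> 1"
  obtains G H \<mu> C where "G \<in> borel_measurable M" "\<And>x. \<bar>G x\<bar> \<le> C" "(\<integral>x. G x \<partial>M) = 0"
    "H \<in> borel_measurable P" "\<And>w. \<bar>H w\<bar> \<le> C"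
    "\<And>n. (\<integral>w. (\<Sum>i\<in>tuples k n. H (\<lambda>a. w (i a)))\<^sup>2 \<partial>P) \<le> 4 * C\<^sup>2 * real k ^ 4 * real n ^ (2 * k - 2)"
    "\<And>n w. (\<Sum>i\<in>tuples k n. h (\<lambda>a. w (i a))) =
       real n ^ k * \<mu> + real n ^ (k - 1) * (\<Sum>v=1..n. G (w v)) + (\<Sum>i\<in>tuples k n. H (\<lambda>a. w (i a)))"
proof -
  define \<mu> where "\<mu> = (\<integral>w. h w \<partial>P)"
  define g where "g j x = (\<integral>w. h (w(j := x)) \<partial>P) - \<mu>" for j x
  define G where "G x = (\<Sum>j=1..k. g j x)" for x
  define H where "H w = h w - \<mu> - (\<Sum>j=1..k. g j (w j))" for w
  have \<mu>1: "\<bar>\<mu>\<bar> \<le> 1"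
    unfolding \<mu>_def by (rule abs_integral_le[OF h1])
  have g2: "\<bar>g j x\<bar> \<le> 2" for j x
    using abs_integral_le[OF h1, of "\<lambda>w. w(j := x)"] \<mu>1 unfolding g_def by linarith
  have gm [measurable]: "g j \<in> borel_measurable M" for j
  proof -
    have "(\<lambda>(x, w). h (w(j := x))) \<in> borel_measurable (M \<Otimes>\<^sub>M P)"
      using measurable_compose[OF measurable_upd h] by (simp add: case_prod_unfold)
    then have "(\<lambda>x. \<integral>w. h (w(j := x)) \<partial>P) \<in> borel_measurable M"
      by (rule seq.borel_measurable_lebesgue_integral)
    then show ?thesis unfolding g_def[abs_def] by measurable
  qed
  have intg: "integrable M (g j)" for j
    by (rule integrable_const_bound[where B = 2]) (auto simp: g2)
  have inth: "integrable P h"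
    by (rule integrable_bounded[OF h h1])
  have intgw: "integrable P (\<lambda>w. g j (w l))" for j l
    by (rule integrable_bounded[where C = 2]) (auto simp: g2)
  have g0: "(\<integral>x. g j x \<partial>M) = 0" for j
  proof -
    have "(\<lambda>(x, w). h (w(j := x))) \<in> borel_measurable (M \<Otimes>\<^sub>M P)"
      using measurable_compose[OF measurable_upd h] by (simp add: case_prod_unfold)
    then have m: "(\<lambda>x. \<integral>w. h (w(j := x)) \<partial>P) \<in> borel_measurable M"
      by (rule seq.borel_measurable_lebesgue_integral)
    have "integrable M (\<lambda>x. \<integral>w. h (w(j := x)) \<partial>P)"
      by (rule integrable_const_bound[where B = 1]) (use m h1 abs_integral_le in auto)
    then have "(\<integral>x. g j x \<partial>M) = (\<integral>x. \<integral>w. h (w(j := x)) \<partial>P \<partial>M) - \<mu>"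
      unfolding g_def by (simp add: prob_space)
    then show ?thesis
      using integral_resample[OF h h1, of j] by (simp add: \<mu>_def)
  qed
  have gw0: "(\<integral>w. g j (w l) \<partial>P) = 0" for j l
  proof -
    have "(\<integral>w. g j (w l) \<partial>P) = (\<integral>x. g j x \<partial>distr P M (\<lambda>w. w l))"
      by (subst integral_distr) auto
    then show ?thesis by (simp add: distr_coord g0)
  qed
  have sg: "\<bar>\<Sum>j=1..k. g j (x j)\<bar> \<le> 2 * real k" for x
    using order_trans[OF sum_abs sum_mono[of "{1..k}" "\<lambda>j. \<bar>g j (x j)\<bar>" "\<lambda>_. 2"]] g2 by fastforce
  show ?thesis
  \<comment> \<open>\<open>h\<close> and its mean contribute at most 1 each, and each of the k
    projections at most 2.\<close>
  proof (rule that[of G "2 + 2 * real k" H \<mu>])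
    show "G \<in> borel_measurable M" unfolding G_def[abs_def] by measurable
    show "\<bar>G x\<bar> \<le> 2 + 2 * real k" for x
      using sg[of "\<lambda>_. x"] unfolding G_def by linarith
    show "(\<integral>x. G x \<partial>M) = 0"
      unfolding G_def by (subst Bochner_Integration.integral_sum) (auto simp: intg g0)
    show Hm: "H \<in> borel_measurable P"
      unfolding H_def[abs_def] using h by measurable
    show HC: "\<bar>H w\<bar> \<le> 2 + 2 * real k" for w
      using sg[of w] h1[of w] \<mu>1 unfolding H_def by linarith
    have Hdep: "depends_on {1..k} H"
      unfolding depends_on_def
    proof (intro allI impI)
      fix w w' :: "nat \<Rightarrow> 'a" assume eq: "\<forall>i\<in>{1..k}. w i = w' i"
      then have "h w = h w'" by (intro depends_onD[OF dep]) auto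
      moreover have "(\<Sum>j=1..k. g j (w j)) = (\<Sum>j=1..k. g j (w' j))"
        using eq by (intro sum.cong) auto
      ultimately show "H w = H w'" unfolding H_def by simp
    qed
    have zero: "(\<integral>w. H (w(j := x)) \<partial>P) = 0" if j: "j \<in> {1..k}" and x: "x \<in> space M" for j x
    proof -
      have 1: "(\<Sum>l=1..k. g l ((w(j := x)) l)) = g j x + (\<Sum>l\<in>{1..k}-{j}. g l (w l))" for w
      proof -
        have "(\<Sum>l\<in>{1..k}-{j}. g l ((w(j := x)) l)) = (\<Sum>l\<in>{1..k}-{j}. g l (w l))"
          by (rule sum.cong) auto
        then show ?thesis
          using sum.remove[of "{1..k}" j "\<lambda>l. g l ((w(j := x)) l)"] j by simp
      qed
      have "integrable P (\<lambda>w. h (w(j := x)))"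
        by (rule integrable_bounded[OF measurable_compose[OF measurable_upd1[OF x] h] h1])
      then have "(\<integral>w. H (w(j := x)) \<partial>P) =
          (\<integral>w. h (w(j := x)) \<partial>P) - \<mu> - (g j x + (\<Sum>l\<in>{1..k}-{j}. \<integral>w. g l (w l) \<partial>P))"
        unfolding H_def 1 using intgw by (simp add: seq.prob_space)
      also have "\<dots> = 0"
        unfolding gw0 by (simp add: g_def)
      finally show ?thesis .
    qed
    show "(\<integral>w. (\<Sum>i\<in>tuples k n. H (\<lambda>a. w (i a)))\<^sup>2 \<partial>P)
        \<le> 4 * (2 + 2 * real k)\<^sup>2 * real k ^ 4 * real n ^ (2 * k - 2)" for n
      by (rule second_moment_degenerate[OF Hm HC Hdep zero k])
    show "(\<Sum>i\<in>tuples k n. h (\<lambda>a. w (i a))) =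
       real n ^ k * \<mu> + real n ^ (k - 1) * (\<Sum>v=1..n. G (w v)) + (\<Sum>i\<in>tuples k n. H (\<lambda>a. w (i a)))" for n w
    proof -
      have "(\<Sum>i\<in>tuples k n. \<Sum>j=1..k. g j (w (i j))) = (\<Sum>j=1..k. \<Sum>i\<in>tuples k n. g j (w (i j)))"
        by (rule sum.swap)
      also have "\<dots> = (\<Sum>j=1..k. real n ^ (k - 1) * (\<Sum>v=1..n. g j (w v)))"
        by (intro sum.cong refl) (rule sum_tuples_component)
      also have "\<dots> = real n ^ (k - 1) * (\<Sum>v=1..n. G (w v))"
        unfolding G_def sum_distrib_left[symmetric] by (subst sum.swap) simp
      finally have *: "(\<Sum>i\<in>tuples k n. \<Sum>j=1..k. g j (w (i j))) = \<dots>" .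
      have "(\<Sum>i\<in>tuples k n. H (\<lambda>a. w (i a))) = (\<Sum>i\<in>tuples k n. h (\<lambda>a. w (i a)))
          - real n ^ k * \<mu> - (\<Sum>i\<in>tuples k n. \<Sum>j=1..k. g j (w (i j)))"
        unfolding H_def sum_subtractf sum_constant card_tuples by simp
      with * show ?thesis by simp
    qed
  qed
qed

text \<open>Dividing by n ^ (k - 1 / 2) = n ^ (k - 1) * sqrt n turns the linear part into a
  normalised i.i.d. sum \<open>A\<close>, whose second moment is exactly s ^ 2 for n \<ge> 1. The
  centred remainder becomes \<open>B\<close>, with second moment O(n ^ (2 k - 2) / n ^ (2 k - 1)) =
  O(1 / n).\<close>

theorem V_statistic_asymptotically_normal:
  fixes h :: "(nat \<Rightarrow> 'a) \<Rightarrow> real"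
  assumes h: "h \<in> borel_measurable P" and h1: "\<And>w. \<bar>h w\<bar> \<le> 1" and dep: "depends_on {1..k} h"
    and k: "k \<ge> 1"
  defines "V n w \<equiv> (\<Sum>i\<in>tuples k n. h (\<lambda>a. w (i a)))"
  shows "\<exists>s\<ge>0. (\<lambda>n. seq.variance (V n) / real n ^ (2 * k - 1)) \<longlonglongrightarrow> s\<^sup>2 \<and>
    weak_conv_m (\<lambda>n. distr P borel (\<lambda>w. (V n w - seq.expectation (V n)) / real n powr (real k - 1 / 2)))
      (centered_normal s)"
proof -
  obtain G C H \<mu> where G [measurable]: "G \<in> borel_measurable M" and GC: "\<And>x. \<bar>G x\<bar> \<le> C"
    and G0: "(\<integral>x. G x \<partial>M) = 0" and H: "H \<in> borel_measurable P" and HC: "\<And>w. \<bar>H w\<bar> \<le> C"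
    and H2: "\<And>n. (\<integral>w. (\<Sum>i\<in>tuples k n. H (\<lambda>a. w (i a)))\<^sup>2 \<partial>P) \<le> 4 * C\<^sup>2 * real k ^ 4 * real n ^ (2 * k - 2)"
    and decomp: "\<And>n w. (\<Sum>i\<in>tuples k n. h (\<lambda>a. w (i a))) =
       real n ^ k * \<mu> + real n ^ (k - 1) * (\<Sum>v=1..n. G (w v)) + (\<Sum>i\<in>tuples k n. H (\<lambda>a. w (i a)))"
    by (rule hoeffding_decomposition[OF h h1 dep k]) (rule that)
  define R where "R n w = (\<Sum>i\<in>tuples k n. H (\<lambda>a. w (i a)))" for n w
  define c where "c n = real n powr (real k - 1 / 2)" for n :: nat
  define A where "A n w = (\<Sum>v=1..n. G (w v)) / sqrt n" for n :: nat and w :: "nat \<Rightarrow> 'a"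
  define B where "B n w = (R n w - seq.expectation (R n)) / c n" for n w
  define s where "s = sqrt (\<integral>x. (G x)\<^sup>2 \<partial>M)"
  have s: "s \<ge> 0" "s\<^sup>2 = (\<integral>x. (G x)\<^sup>2 \<partial>M)"
    by (simp_all add: s_def)
  have [measurable]: "(\<lambda>w. H (\<lambda>a. w (i a))) \<in> borel_measurable P" for i
    by (rule measurable_compose[OF measurable_reindex H])
  have [measurable]: "R n \<in> borel_measurable P" "A n \<in> borel_measurable P" for n
    unfolding R_def[abs_def] A_def[abs_def] by measurable
  then have [measurable]: "B n \<in> borel_measurable P" for n
    unfolding B_def[abs_def] by measurable
  have RC: "\<bar>R n w\<bar> \<le> real n ^ k * C" for n w
    using order_trans[OF sum_abs sum_mono[of "tuples k n" _ "\<lambda>_. C"], OF HC]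
    unfolding R_def by (simp only: sum_constant card_tuples of_nat_power)
  have AC: "\<bar>\<Sum>v=1..n. G (w v)\<bar> \<le> real n * C" for n w
    using order_trans[OF sum_abs sum_mono[of "{1..n}" _ "\<lambda>_. C"], of "\<lambda>v. G (w v)"] GC by simp
  have intR: "integrable P (R n)" for n
    by (rule integrable_bounded[OF _ RC]) measurable
  have sq: "integrable P (\<lambda>w. (f w)\<^sup>2)" if [measurable]: "f \<in> borel_measurable P" and "\<And>w. \<bar>f w\<bar> \<le> D"
    for f :: "(nat \<Rightarrow> 'a) \<Rightarrow> real" and D
  proof (rule integrable_bounded)
    show "\<bar>(f w)\<^sup>2\<bar> \<le> D\<^sup>2" for w
      using power_mono[OF that(2) abs_ge_zero, of w 2] by simp
  qed measurable
  have intR2: "integrable P (\<lambda>w. (R n w)\<^sup>2)" for n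
    by (rule sq[OF _ RC]) measurable
  have intA2: "integrable P (\<lambda>w. (A n w)\<^sup>2)" for n
  proof (rule sq)
    show "\<bar>A n w\<bar> \<le> real n * C / sqrt n" for w
      unfolding A_def abs_divide using divide_right_mono[OF AC, of "sqrt n"] by simp
  qed measurable
  have intB2: "integrable P (\<lambda>w. (B n w)\<^sup>2)" for n
  proof -
    have "(B n w)\<^sup>2 = ((R n w)\<^sup>2 - 2 * seq.expectation (R n) * R n w + (seq.expectation (R n))\<^sup>2) / (c n)\<^sup>2" for w
      unfolding B_def by (simp add: power_divide power2_diff algebra_simps)
    then show ?thesis using intR intR2 by simp
  qed
  have c2: "(c n)\<^sup>2 = real n ^ (2 * k - 1)" if "n \<ge> 1" for n
  proof -
    have "(c n)\<^sup>2 = real n powr (real (2 * k - 1))"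
      unfolding c_def power2_eq_square powr_add[symmetric] using k by (simp add: of_nat_diff)
    also have "\<dots> = real n ^ (2 * k - 1)"
      using that by (intro powr_realpow) simp
    finally show ?thesis .
  qed
  have cc: "c n = real n ^ (k - 1) * sqrt n" if "n \<ge> 1" for n
  proof -
    have "real k - 1 / 2 = real (k - 1) + 1 / 2" using k by (simp add: of_nat_diff)
    then have "c n = real n powr real (k - 1) * real n powr (1 / 2)"
      unfolding c_def by (simp only: powr_add)
    then show ?thesis
      using that by (simp add: powr_realpow powr_half_sqrt)
  qed
  define K where "K = 4 * C\<^sup>2 * real k ^ 4"
  have EB: "seq.expectation (\<lambda>w. (B n w)\<^sup>2) \<le> K / real n" if n: "n \<ge> 1" for n
  proof -
    have "seq.expectation (\<lambda>w. (B n w)\<^sup>2) = seq.variance (R n) / (c n)\<^sup>2"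
      unfolding B_def by (simp add: power_divide)
    also have "seq.variance (R n) \<le> seq.expectation (\<lambda>w. (R n w)\<^sup>2)"
      using seq.variance_eq[OF intR intR2, of n] by simp
    also have "\<dots> \<le> K * real n ^ (2 * k - 2)"
      using H2[of n] unfolding R_def K_def .
    finally have "seq.expectation (\<lambda>w. (B n w)\<^sup>2) \<le> K * real n ^ (2 * k - 2) / (c n)\<^sup>2"
      by (simp add: divide_right_mono)
    also have "\<dots> = K / real n"
    proof -
      have "2 * k - 1 = Suc (2 * k - 2)" using k by simp
      then show ?thesis using n by (simp add: c2[OF n])
    qed
    finally show ?thesis .
  qed
  have VR: "V n w - seq.expectation (V n) = real n ^ (k - 1) * (\<Sum>v=1..n. G (w v)) + (R n w - seq.expectation (R n))"
    for n w
  proof -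
    have intG: "integrable P (\<lambda>w. \<Sum>v=1..n. G (w v))"
      by (rule integrable_bounded[OF _ AC]) measurable
    have "(\<integral>w. G (w v) \<partial>P) = (\<integral>x. G x \<partial>distr P M (\<lambda>w. w v))" for v
      by (subst integral_distr) auto
    then have "(\<integral>w. G (w v) \<partial>P) = 0" for v by (simp add: distr_coord G0)
    moreover have "integrable P (\<lambda>w. G (w v))" for v
      by (rule integrable_bounded[OF _ GC]) measurable
    ultimately have 0: "seq.expectation (\<lambda>w. \<Sum>v=1..n. G (w v)) = 0"
      by simp
    have "seq.expectation (V n) = seq.expectation (\<lambda>w. real n ^ k * \<mu> + real n ^ (k - 1) * (\<Sum>v=1..n. G (w v)) + R n w)"
      unfolding V_def decomp R_def ..
    also have "\<dots> = real n ^ k * \<mu> + real n ^ (k - 1) * 0 + seq.expectation (R n)"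
      using intG intR unfolding 0[symmetric] by (simp add: seq.prob_space)
    finally show ?thesis
      unfolding V_def decomp R_def by simp
  qed
  have VAB: "(V n w - seq.expectation (V n)) / c n = A n w + B n w" for n w
  proof (cases "n = 0")
    \<comment> \<open>Here \<open>0 powr x = 0\<close> and division by zero gives zero, so the
      identity also holds at n = 0 and the two sequences of laws agree term by term.\<close>
    case True
    then have "c n = 0" by (simp add: c_def)
    then show ?thesis using True by (simp add: A_def B_def)
  next
    case False
    then show ?thesis
      unfolding VR B_def add_divide_distrib A_def using cc[of n] by simp
  qed
  note lim = seq.normal_limit_perturbation[of A B s K]
  have EA: "seq.expectation (\<lambda>w. (A n w)\<^sup>2) = s\<^sup>2" if "n \<ge> 1" for n
    unfolding A_def s(2) by (rule normalized_sum_second_moment[OF G GC G0 that])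
  have ch: "(\<lambda>n. char (distr P borel (A n)) t) \<longlonglongrightarrow> of_real (exp (- ((s * t)\<^sup>2) / 2))" for t
    unfolding A_def by (rule normalized_sum_char_tendsto[OF G GC G0 s])
  have "(\<lambda>n. seq.expectation (\<lambda>w. (A n w + B n w)\<^sup>2)) \<longlonglongrightarrow> s\<^sup>2"
    by (rule lim(1)) (use s intA2 intB2 EA EB ch in auto)
  moreover have "eventually (\<lambda>n. seq.expectation (\<lambda>w. (A n w + B n w)\<^sup>2) = seq.variance (V n) / real n ^ (2 * k - 1)) sequentially"
    using eventually_ge_at_top[of 1]
    by eventually_elim (simp add: VAB[symmetric] power_divide c2)
  ultimately have "(\<lambda>n. seq.variance (V n) / real n ^ (2 * k - 1)) \<longlonglongrightarrow> s\<^sup>2"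
    by (rule Lim_transform_eventually)
  moreover have "weak_conv_m (\<lambda>n. distr P borel (\<lambda>w. A n w + B n w)) (centered_normal s)"
    by (rule lim(2)) (use s intA2 intB2 EA EB ch in auto)
  ultimately show ?thesis
    using s(1) unfolding VAB[symmetric] c_def by blast
qed

end

section \<open>Sorting labels\<close>

text \<open>
  The value \<open>v\<close> is listed before \<open>w\<close>. For \<open>v < w\<close> this is \<open>Q (x v) (x w)\<close>, where \<open>Q\<close> is \<open>\<ge>\<close> or \<open>>\<close>
  according to whether ties are broken in favour of the smaller or of the larger value.
\<close>

definition prec :: "('a::linorder \<Rightarrow> 'a \<Rightarrow> bool) \<Rightarrow> (nat \<Rightarrow> 'a) \<Rightarrow> nat \<Rightarrow> nat \<Rightarrow> bool" where
  "prec Q x v w \<longleftrightarrow> (v < w \<and> Q (x v) (x w)) \<or> (w < v \<and> \<not> Q (x w) (x v))"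

abbreviation (input) decreasing_order :: "('a::linorder \<Rightarrow> 'a \<Rightarrow> bool) \<Rightarrow> bool" where
  "decreasing_order Q \<equiv> Q = (\<lambda>a b. a \<ge> b) \<or> Q = (\<lambda>a b. a > b)"

text \<open>Only neighbouring positions are compared, since this is the form that becomes a
  \<open>chain\<close> with strict drops at the descents or ascents of \<open>p\<close>; the full
  order follows by transitivity.\<close>

definition sorts :: "('a::linorder \<Rightarrow> 'a \<Rightarrow> bool) \<Rightarrow> nat \<Rightarrow> (nat \<Rightarrow> nat) \<Rightarrow> (nat \<Rightarrow> 'a) \<Rightarrow> bool" where
  "sorts Q n p x \<longleftrightarrow> (\<forall>i\<in>{1..<n}. prec Q x (p i) (p (i + 1)))"

lemma prec_irrefl: "\<not> prec Q x v v"
  by (simp add: prec_def)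

lemma prec_linear: "v \<noteq> w \<Longrightarrow> prec Q x v w \<longleftrightarrow> \<not> prec Q x w v"
  by (auto simp: prec_def)

text \<open>The order is lexicographic: decreasing in the label, then increasing in the value
  (decreasing in the next lemma). Transitivity is evident in this form.\<close>

lemma prec_ge_iff: "prec (\<lambda>a b. a \<ge> b) x v w \<longleftrightarrow> x w < x v \<or> (x w = x v \<and> v < w)"
  by (cases v w rule: linorder_cases) (auto simp: prec_def)

lemma prec_gt_iff: "prec (\<lambda>a b. a > b) x v w \<longleftrightarrow> x w < x v \<or> (x w = x v \<and> w < v)"
  by (cases v w rule: linorder_cases) (auto simp: prec_def)

lemma prec_trans:
  assumes "decreasing_order Q" "prec Q x u v" "prec Q x v w"
  shows "prec Q x u w"
  using assms(1)
proof
  assume "Q = (\<lambda>a b. a \<ge> b)"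
  with assms(2,3) show ?thesis by (auto simp: prec_ge_iff)
next
  assume "Q = (\<lambda>a b. a > b)"
  with assms(2,3) show ?thesis by (auto simp: prec_gt_iff)
qed

lemma sorts_less:
  assumes Q: "decreasing_order Q" and s: "sorts Q n p x" and "1 \<le> i" "i < j" "j \<le> n"
  shows "prec Q x (p i) (p j)"
proof -
  have "Suc i + d \<le> n \<Longrightarrow> prec Q x (p i) (p (Suc i + d))" for d
  proof (induction d)
    case 0
    then show ?case using s \<open>1 \<le> i\<close> by (auto simp: sorts_def)
  next
    case (Suc d)
    have "prec Q x (p (Suc i + d)) (p (Suc i + Suc d))"
      using s Suc.prems \<open>1 \<le> i\<close> unfolding sorts_def by (auto dest!: bspec[of _ _ "Suc i + d"])
    with Suc prec_trans[OF Q] show ?case by force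
  qed
  from this[of "j - Suc i"] show ?thesis using assms by simp
qed

lemma sorts_iff:
  assumes Q: "decreasing_order Q" and s: "sorts Q n p x"
    and ij: "i \<in> {1..n}" "j \<in> {1..n}"
  shows "prec Q x (p i) (p j) \<longleftrightarrow> i < j"
proof (cases i j rule: linorder_cases)
  case less
  then show ?thesis using sorts_less[OF Q s, of i j] ij by auto
next
  case equal
  then show ?thesis by (simp add: prec_irrefl)
next
  case greater
  then have "prec Q x (p j) (p i)" using sorts_less[OF Q s, of j i] ij by auto
  then show ?thesis
    using greater prec_linear[of "p i" "p j" Q x] prec_irrefl[of Q x "p i"] by (cases "p i = p j") auto
qed

lemma sorts_inv_iff:
  assumes Q: "decreasing_order Q" and p: "p \<in> perms n" and s: "sorts Q n p x"
    and vw: "v \<in> {1..n}" "w \<in> {1..n}"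
  shows "inv p v < inv p w \<longleftrightarrow> prec Q x v w"
proof -
  have p': "p permutes {1..n}" using p by (simp add: perms_def)
  have "inv p v \<in> {1..n}" "inv p w \<in> {1..n}"
    using vw permutes_in_image[OF permutes_inv[OF p']] by blast+
  from sorts_iff[OF Q s this] show ?thesis
    by (simp add: permutes_inverses(1)[OF p'])
qed

text \<open>The position \<open>inv p v\<close> is one more than the number of values listed before
  \<open>v\<close>, a number that depends on the labels alone.\<close>

lemma sorts_unique:
  assumes Q: "decreasing_order Q" and p: "p \<in> perms n" "sorts Q n p x" and p': "p' \<in> perms n" "sorts Q n p' x"
  shows "p = p'"
proof -
  have rank: "inv p v = Suc (card {u \<in> {1..n}. prec Q x u v})"
    if p: "p \<in> perms n" "sorts Q n p x" and v: "v \<in> {1..n}" for p v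
  proof -
    have pp: "p permutes {1..n}" using p by (simp add: perms_def)
    have iv: "inv p v \<in> {1..n}" using v permutes_in_image[OF permutes_inv[OF pp]] by blast
    have "{u \<in> {1..n}. prec Q x u v} = p ` {1..<inv p v}"
    proof safe
      fix u assume u: "u \<in> {1..n}" "prec Q x u v"
      have "inv p u < inv p v" using sorts_inv_iff[OF Q p u(1) v] u(2) by simp
      moreover have "inv p u \<in> {1..n}" using u permutes_in_image[OF permutes_inv[OF pp]] by blast
      ultimately have "inv p u \<in> {1..<inv p v}" by auto
      then show "u \<in> p ` {1..<inv p v}"
        by (metis image_eqI permutes_inverses(1)[OF pp])
    next
      fix i assume i: "i \<in> {1..<inv p v}"
      then have i': "i \<in> {1..n}" using iv by auto
      then show "p i \<in> {1..n}" using permutes_in_image[OF pp] by blast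
      then show "prec Q x (p i) v"
        using sorts_inv_iff[OF Q p _ v, of "p i"] i by (simp add: permutes_inverses(2)[OF pp])
    qed
    then have "card {u \<in> {1..n}. prec Q x u v} = card {1..<inv p v}"
      by (simp add: card_image inj_on_subset[OF permutes_inj[OF pp]])
    then show ?thesis using iv by simp
  qed
  have pp: "p permutes {1..n}" "p' permutes {1..n}"
    using p p' by (simp_all add: perms_def)
  have "inv p v = inv p' v" for v
  proof (cases "v \<in> {1..n}")
    case True
    then show ?thesis using rank[OF p] rank[OF p'] by simp
  next
    case False
    then show ?thesis
      using permutes_not_in[OF permutes_inv[OF pp(1)]] permutes_not_in[OF permutes_inv[OF pp(2)]] by simp
  qed
  then have "inv p = inv p'" by blast
  then show ?thesis using pp by (metis permutes_inv_inv)
qed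

text \<open>Rank each value by the number of values that precede it. The rank increases strictly
  along \<open>prec\<close>, so it is a permutation, and its inverse lists the values in the
  required order.\<close>

lemma sorts_exists:
  assumes Q: "decreasing_order Q"
  shows "\<exists>p\<in>perms n. sorts Q n p x"
proof -
  define S where "S v = {u \<in> {1..n}. prec Q x u v}" for v
  define r where "r v = (if v \<in> {1..n} then Suc (card (S v)) else v)" for v
  have fin: "finite (S v)" for v by (simp add: S_def)
  have less: "r v < r w" if "v \<in> {1..n}" "w \<in> {1..n}" "prec Q x v w" for v w
  proof -
    have "S v \<subseteq> S w" using prec_trans[OF Q _ that(3)] by (auto simp: S_def)
    moreover have "v \<in> S w" "v \<notin> S v" using that by (auto simp: S_def prec_irrefl)
    ultimately have "S v \<subset> S w" by blast
    then show ?thesis using that psubset_card_mono[OF fin] by (simp add: r_def)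
  qed
  have into: "r v \<in> {1..n}" if v: "v \<in> {1..n}" for v
  proof -
    have "S v \<subseteq> {1..n} - {v}" by (auto simp: S_def prec_irrefl)
    then have "card (S v) \<le> card ({1..n} - {v})" by (intro card_mono) auto
    then show ?thesis using v by (auto simp: r_def)
  qed
  have inj: "inj_on r {1..n}"
  proof (rule inj_onI)
    fix v w assume vw: "v \<in> {1..n}" "w \<in> {1..n}" "r v = r w"
    then show "v = w"
      using less[of v w] less[of w v] prec_linear[of v w Q x] by (cases "v = w") auto
  qed
  have "r ` {1..n} = {1..n}"
    by (rule endo_inj_surj) (use into inj in blast)+
  with inj have "bij_betw r {1..n} {1..n}"
    unfolding bij_betw_def by blast
  then have rp: "r permutes {1..n}"
    by (rule bij_imp_permutes) (auto simp: r_def)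
  have "sorts Q n (inv r) x"
    unfolding sorts_def
  proof
    fix i assume "i \<in> {1..<n}"
    then have i: "i \<in> {1..n}" "i + 1 \<in> {1..n}" by auto
    let ?v = "inv r i" and ?w = "inv r (i + 1)"
    have "?v \<in> {1..n}" "?w \<in> {1..n}"
      using i permutes_in_image[OF permutes_inv[OF rp]] by blast+
    moreover have "r ?v = i" "r ?w = i + 1"
      using permutes_inverses(1)[OF rp] by simp_all
    ultimately show "prec Q x ?v ?w"
      using less[of ?w ?v] prec_linear[of ?v ?w Q x] by (cases "?v = ?w") auto
  qed
  moreover have "inv r \<in> perms n"
    using permutes_inv[OF rp] by (simp add: perms_def)
  ultimately show ?thesis by blast
qed

text \<open>Here \<open>i\<close> lists the values of an occurrence in increasing order, not its
  positions: labels belong to values. The condition \<open>inv \<sigma> a < inv \<sigma> b\<close>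
  says that the a-th smallest entry of the pattern stands to the left of the b-th smallest, and
  \<open>Q\<close> says the same about the values \<open>i a\<close> and \<open>i b\<close> in the
  sorted list.\<close>

definition label_count :: "('a::linorder \<Rightarrow> 'a \<Rightarrow> bool) \<Rightarrow> nat \<Rightarrow> (nat \<Rightarrow> nat) \<Rightarrow> nat \<Rightarrow> (nat \<Rightarrow> 'a) \<Rightarrow> real" where
  "label_count Q k \<sigma> n x = (\<Sum>i\<in>tuples k n. of_bool (\<forall>a\<in>{1..k}. \<forall>b\<in>{1..k}. a < b \<longrightarrow>
     i a < i b \<and> (inv \<sigma> a < inv \<sigma> b \<longleftrightarrow> Q (x (i a)) (x (i b)))))"

text \<open>Passing between the positions and the values of an occurrence is a bijection: the a-th
  position carries the value of rank \<sigma> a, so positions are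
  \<open>inv p (i (\<sigma> a))\<close> and values are \<open>p (j (inv \<sigma> b))\<close>.
  Increasing positions correspond to the condition on \<open>Q\<close>, order isomorphism to
  increasing values.\<close>

lemma label_count_eq_pattern_count:
  assumes Q: "decreasing_order Q" and \<sigma>: "\<sigma> \<in> perms k" and p: "p \<in> perms n" and s: "sorts Q n p x"
  shows "label_count Q k \<sigma> n x = pattern_count k \<sigma> n p"
proof -
  let ?K = "{1..k}"
  have \<sigma>p: "\<sigma> permutes ?K" and pp: "p permutes {1..n}" using \<sigma> p by (simp_all add: perms_def)
  note \<sigma>i = permutes_in_image[OF \<sigma>p] permutes_in_image[OF permutes_inv[OF \<sigma>p]]
    and pi = permutes_in_image[OF pp] permutes_in_image[OF permutes_inv[OF pp]]
  define L where "L = {i \<in> tuples k n. \<forall>a\<in>?K. \<forall>b\<in>?K. a < b \<longrightarrow>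
     i a < i b \<and> (inv \<sigma> a < inv \<sigma> b \<longleftrightarrow> Q (x (i a)) (x (i b)))}"
  have Q_iff: "Q (x (i a)) (x (i b)) \<longleftrightarrow> inv p (i a) < inv p (i b)"
    if "i \<in> tuples k n" "a \<in> ?K" "b \<in> ?K" "i a < i b" for i a b
  proof -
    have "i a \<in> {1..n}" "i b \<in> {1..n}" using that by blast+
    from sorts_inv_iff[OF Q p s this] show ?thesis using that(4) by (simp add: prec_def)
  qed
  have L_iff: "i \<in> L \<longleftrightarrow> i \<in> tuples k n \<and>
      (\<forall>a\<in>?K. \<forall>b\<in>?K. a < b \<longrightarrow> i a < i b \<and> (inv \<sigma> a < inv \<sigma> b \<longleftrightarrow> inv p (i a) < inv p (i b)))" for i
    unfolding L_def using Q_iff by blast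
  have L_mono: "i a < i b \<longleftrightarrow> a < b" "inv p (i a) < inv p (i b) \<longleftrightarrow> inv \<sigma> a < inv \<sigma> b"
    if i: "i \<in> L" and a: "a \<in> ?K" and b: "b \<in> ?K" for i a b
  proof -
    have *: "i a < i b \<and> (inv \<sigma> a < inv \<sigma> b \<longleftrightarrow> inv p (i a) < inv p (i b))" if "a \<in> ?K" "b \<in> ?K" "a < b" for a b
      using i that L_iff by blast
    have "inj (inv p)" "inj (inv \<sigma>)"
      using permutes_inj[OF permutes_inv] pp \<sigma>p by blast+
    then have ne: "inv \<sigma> a \<noteq> inv \<sigma> b" "inv p (i a) \<noteq> inv p (i b)" if "a \<noteq> b" "i a \<noteq> i b"
      using that by (auto dest: injD)
    show "i a < i b \<longleftrightarrow> a < b"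
      using *[OF a b] *[OF b a] by (cases a b rule: linorder_cases) auto
    show "inv p (i a) < inv p (i b) \<longleftrightarrow> inv \<sigma> a < inv \<sigma> b"
      using *[OF a b] *[OF b a] ne by (cases a b rule: linorder_cases) (auto simp: not_less less_le)
  qed
  have "bij_betw (\<lambda>i. \<lambda>a\<in>?K. inv p (i (\<sigma> a))) L (occurrences k \<sigma> n p)"
  proof (rule bij_betw_byWitness[where f' = "\<lambda>j. \<lambda>b\<in>?K. p (j (inv \<sigma> b))"])
    show "\<forall>i\<in>L. (\<lambda>b\<in>?K. p ((\<lambda>a\<in>?K. inv p (i (\<sigma> a))) (inv \<sigma> b))) = i"
    proof
      fix i assume "i \<in> L"
      then have i: "i \<in> tuples k n" by (simp add: L_iff)
      show "(\<lambda>b\<in>?K. p ((\<lambda>a\<in>?K. inv p (i (\<sigma> a))) (inv \<sigma> b))) = i"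
      proof
        fix b show "(\<lambda>b\<in>?K. p ((\<lambda>a\<in>?K. inv p (i (\<sigma> a))) (inv \<sigma> b))) b = i b"
          using i \<sigma>i(2)[of b] permutes_inverses(1)[OF pp] permutes_inverses(1)[OF \<sigma>p]
          by (cases "b \<in> ?K") (simp_all only: restrict_apply if_True if_False PiE_arb[OF i] simp_thms)
      qed
    qed
    show "\<forall>j\<in>occurrences k \<sigma> n p. (\<lambda>a\<in>?K. inv p ((\<lambda>b\<in>?K. p (j (inv \<sigma> b))) (\<sigma> a))) = j"
    proof
      fix j assume "j \<in> occurrences k \<sigma> n p"
      then have j: "j \<in> tuples k n" by (simp add: occurrences_def)
      show "(\<lambda>a\<in>?K. inv p ((\<lambda>b\<in>?K. p (j (inv \<sigma> b))) (\<sigma> a))) = j"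
      proof
        fix a show "(\<lambda>a\<in>?K. inv p ((\<lambda>b\<in>?K. p (j (inv \<sigma> b))) (\<sigma> a))) a = j a"
          using j \<sigma>i(1)[of a] permutes_inverses(2)[OF pp] permutes_inverses(2)[OF \<sigma>p]
          by (cases "a \<in> ?K") (simp_all only: restrict_apply if_True if_False PiE_arb[OF j] simp_thms)
      qed
    qed
    show "(\<lambda>i. \<lambda>a\<in>?K. inv p (i (\<sigma> a))) ` L \<subseteq> occurrences k \<sigma> n p"
    proof (rule image_subsetI)
      fix i assume iL: "i \<in> L"
      then have i: "i \<in> tuples k n" by (simp add: L_iff)
      let ?j = "\<lambda>a\<in>?K. inv p (i (\<sigma> a))"
      have jt: "?j \<in> tuples k n"
        unfolding restrict_PiE_iff using i \<sigma>i(1) pi(2) by blast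
      have "?j a < ?j b \<longleftrightarrow> a < b" if "a \<in> ?K" "b \<in> ?K" for a b
        using L_mono(2)[OF iL, of "\<sigma> a" "\<sigma> b"] that \<sigma>i(1) permutes_inverses(2)[OF \<sigma>p]
        by (simp del: atLeastAtMost_iff One_nat_def)
      moreover have "p (?j a) < p (?j b) \<longleftrightarrow> \<sigma> a < \<sigma> b" if "a \<in> ?K" "b \<in> ?K" for a b
        using L_mono(1)[OF iL, of "\<sigma> a" "\<sigma> b"] that \<sigma>i(1) permutes_inverses(1)[OF pp]
        by (simp del: atLeastAtMost_iff One_nat_def)
      ultimately show "?j \<in> occurrences k \<sigma> n p"
        using jt unfolding occurrences_def order_isomorphic_on_def strict_mono_on_def by blast
    qed
    show "(\<lambda>j. \<lambda>b\<in>?K. p (j (inv \<sigma> b))) ` occurrences k \<sigma> n p \<subseteq> L"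
    proof (rule image_subsetI)
      fix j assume jo: "j \<in> occurrences k \<sigma> n p"
      then have j: "j \<in> tuples k n" and jm: "strict_mono_on ?K j"
        and ji: "\<And>a b. a \<in> ?K \<Longrightarrow> b \<in> ?K \<Longrightarrow> p (j a) < p (j b) \<longleftrightarrow> \<sigma> a < \<sigma> b"
        by (simp_all add: occurrences_def order_isomorphic_on_def)
      let ?i = "\<lambda>b\<in>?K. p (j (inv \<sigma> b))"
      have it: "?i \<in> tuples k n"
        unfolding restrict_PiE_iff using j \<sigma>i(2) pi(1) by blast
      have "?i a < ?i b" if "a \<in> ?K" "b \<in> ?K" "a < b" for a b
        using ji[of "inv \<sigma> a" "inv \<sigma> b"] that \<sigma>i(2) permutes_inverses(1)[OF \<sigma>p]
        by (simp del: atLeastAtMost_iff One_nat_def)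
      moreover have "inv p (?i a) < inv p (?i b) \<longleftrightarrow> inv \<sigma> a < inv \<sigma> b" if "a \<in> ?K" "b \<in> ?K" for a b
        using strict_mono_on_less[OF jm, of "inv \<sigma> a" "inv \<sigma> b"] that \<sigma>i(2) permutes_inverses(2)[OF pp]
        by (simp del: atLeastAtMost_iff One_nat_def)
      ultimately show "?i \<in> L"
        unfolding L_iff using it by blast
    qed
  qed
  then have "card L = card (occurrences k \<sigma> n p)"
    by (rule bij_betw_same_card)
  moreover have "label_count Q k \<sigma> n x = real (card L)"
    unfolding label_count_def L_def of_bool_def sum.inter_filter[OF finite_tuples, symmetric] by simp
  ultimately show ?thesis by (simp add: pattern_count_def)
qed

section \<open>Symmetrization\<close>

lemma pred_decreasing_order:
  fixes f g :: "'b \<Rightarrow> 'a :: {linorder_topology, second_countable_topology}"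
  assumes Q: "decreasing_order Q" and [measurable]: "f \<in> borel_measurable M" "g \<in> borel_measurable M"
  shows "Measurable.pred M (\<lambda>x. Q (f x) (g x))"
  using Q by (elim disjE) simp_all

lemma borel_measurable_of_bool:
  "Measurable.pred M p \<Longrightarrow> (\<lambda>x. of_bool (p x) :: real) \<in> borel_measurable M"
  unfolding of_bool_def by measurable

text \<open>Checked on cylinders. By Fubini the slice at x is again a cylinder, of measure a product
  over j of functions of the single coordinate \<open>x j\<close>; independence of these coordinates
  lets the integral pass inside the product.\<close>

lemma distr_pair_sequences:
  assumes "prob_space N" "prob_space U"
  shows "distr (iid_seq.P N \<Otimes>\<^sub>M iid_seq.P U) (iid_seq.P (N \<Otimes>\<^sub>M U)) (\<lambda>(x, y) i. (x i, y i)) =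
    iid_seq.P (N \<Otimes>\<^sub>M U)"
proof -
  interpret N: iid_seq N by (intro iid_seq.intro assms)
  interpret U: iid_seq U by (intro iid_seq.intro assms)
  interpret NU: pair_prob_space N U ..
  interpret Z: iid_seq "N \<Otimes>\<^sub>M U" by (intro iid_seq.intro NU.prob_space_axioms)
  interpret XY: pair_prob_space N.P U.P ..
  interpret ZP: product_prob_space "\<lambda>_. N \<Otimes>\<^sub>M U" "UNIV :: nat set" ..
  interpret UP: product_prob_space "\<lambda>_. U" "UNIV :: nat set" ..
  have m: "(\<lambda>(x, y) i. (x i, y i)) \<in> measurable (N.P \<Otimes>\<^sub>M U.P) Z.P"
    unfolding case_prod_unfold
    by (intro Z.measurable_into_P measurable_Pair measurable_compose[OF measurable_fst N.measurable_coord]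
        measurable_compose[OF measurable_snd U.measurable_coord])
  show ?thesis
    unfolding Z.P_def
  proof (rule ZP.PiM_eq)
    fix J :: "nat set" and F assume J: "finite J" and F: "\<And>j. j \<in> J \<Longrightarrow> F j \<in> sets (N \<Otimes>\<^sub>M U)"
    let ?E = "prod_emb UNIV (\<lambda>_. N \<Otimes>\<^sub>M U) J (\<Pi>\<^sub>E j\<in>J. F j)"
    have E: "?E \<in> sets Z.P"
      unfolding Z.P_def using J F by (intro sets_PiM_I) auto
    define B where "B = (\<lambda>(x, y) i. (x i, y i)) -` ?E \<inter> space (N.P \<Otimes>\<^sub>M U.P)"
    have B: "B \<in> sets (N.P \<Otimes>\<^sub>M U.P)"
      unfolding B_def by (rule measurable_sets[OF m E])
    have slice: "Pair x -` B = {y \<in> space (PiM UNIV (\<lambda>_. U)). \<forall>j\<in>J. y j \<in> Pair (x j) -` F j}"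
      if "x \<in> space N.P" for x
      using that unfolding B_def prod_emb_def
      by (auto simp: space_pair_measure N.space_P U.space_P space_PiM PiE_iff extensional_def)
    have "emeasure (distr (N.P \<Otimes>\<^sub>M U.P) Z.P (\<lambda>(x, y) i. (x i, y i))) ?E = emeasure (N.P \<Otimes>\<^sub>M U.P) B"
      unfolding B_def by (rule emeasure_distr[OF m E])
    also have "\<dots> = (\<integral>\<^sup>+x. emeasure U.P (Pair x -` B) \<partial>N.P)"
      by (rule U.seq.emeasure_pair_measure_alt[OF B])
    also have "\<dots> = (\<integral>\<^sup>+x. (\<Prod>j\<in>J. emeasure U (Pair (x j) -` F j)) \<partial>N.P)"
    proof (rule nn_integral_cong)
      fix x assume x: "x \<in> space N.P"
      show "emeasure U.P (Pair x -` B) = (\<Prod>j\<in>J. emeasure U (Pair (x j) -` F j))"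
        unfolding slice[OF x] U.P_def
        by (rule UP.emeasure_PiM_Collect) (use J F in \<open>auto intro: sets_Pair1\<close>)
    qed
    also have "\<dots> = (\<Prod>j\<in>J. \<integral>\<^sup>+x. emeasure U (Pair (x j) -` F j) \<partial>N.P)"
    proof (rule N.seq.indep_vars_nn_integral[OF J])
      show "N.seq.indep_vars (\<lambda>_. borel) (\<lambda>j x. emeasure U (Pair (x j) -` F j)) J"
        by (rule N.seq.indep_vars_compose2[OF N.seq.indep_vars_subset[OF N.indep_coords]])
           (use F in \<open>auto intro: U.measurable_emeasure_Pair\<close>)
    qed simp
    also have "\<dots> = (\<Prod>j\<in>J. emeasure (N \<Otimes>\<^sub>M U) (F j))"
    proof (rule prod.cong[OF refl])
      fix j assume j: "j \<in> J"
      have [measurable]: "(\<lambda>x. emeasure U (Pair x -` F j)) \<in> borel_measurable N"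
        using F[OF j] by (rule U.measurable_emeasure_Pair)
      have "(\<integral>\<^sup>+x. emeasure U (Pair (x j) -` F j) \<partial>N.P) =
          (\<integral>\<^sup>+x. emeasure U (Pair x -` F j) \<partial>distr N.P N (\<lambda>x. x j))"
        by (subst nn_integral_distr) auto
      then show "(\<integral>\<^sup>+x. emeasure U (Pair (x j) -` F j) \<partial>N.P) = emeasure (N \<Otimes>\<^sub>M U) (F j)"
        by (simp add: N.distr_coord U.emeasure_pair_measure_alt[OF F[OF j]])
    qed
    finally show "emeasure (distr (N.P \<Otimes>\<^sub>M U.P) (Pi\<^sub>M UNIV (\<lambda>_. N \<Otimes>\<^sub>M U)) (\<lambda>(x, y) i. (x i, y i))) ?E =
        (\<Prod>j\<in>J. emeasure (N \<Otimes>\<^sub>M U) (F j))"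
      by (simp add: Z.P_def)
  qed simp
qed

text \<open>
  The kernel vanishes unless the uniform marks increase along the tuple, so non-injective tuples
  contribute nothing and each set of \<open>k\<close> indices is counted in exactly one order.
\<close>

definition symmetric_kernel ::
  "('a::linorder \<Rightarrow> 'a \<Rightarrow> bool) \<Rightarrow> nat \<Rightarrow> (nat \<Rightarrow> nat) \<Rightarrow> (nat \<Rightarrow> 'a \<times> real) \<Rightarrow> real" where
  "symmetric_kernel Q k \<sigma> z = of_bool (\<forall>a\<in>{1..k}. \<forall>b\<in>{1..k}. a < b \<longrightarrow>
     snd (z a) < snd (z b) \<and> (inv \<sigma> a < inv \<sigma> b \<longleftrightarrow> Q (fst (z a)) (fst (z b))))"

lemma label_count_depends_on: "depends_on {1..n} (label_count Q k \<sigma> n)"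
  unfolding depends_on_def
proof (intro allI impI)
  fix x x' :: "nat \<Rightarrow> 'a" assume eq: "\<forall>i\<in>{1..n}. x i = x' i"
  show "label_count Q k \<sigma> n x = label_count Q k \<sigma> n x'"
    unfolding label_count_def
  proof (rule sum.cong[OF refl])
    fix i assume "i \<in> tuples k n"
    then have e: "x (i a) = x' (i a)" if "a \<in> {1..k}" for a
      using eq that by blast
    show "of_bool (\<forall>a\<in>{1..k}. \<forall>b\<in>{1..k}. a < b \<longrightarrow>
        i a < i b \<and> (inv \<sigma> a < inv \<sigma> b \<longleftrightarrow> Q (x (i a)) (x (i b)))) =
      (of_bool (\<forall>a\<in>{1..k}. \<forall>b\<in>{1..k}. a < b \<longrightarrow>
        i a < i b \<and> (inv \<sigma> a < inv \<sigma> b \<longleftrightarrow> Q (x' (i a)) (x' (i b)))) :: real)"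
      by (intro arg_cong[where f = of_bool] ball_cong refl) (simp only: e)
  qed
qed

text \<open>Let \<tau> list the indices by increasing mark. Rewriting every tuple through \<tau>
  turns increasing marks into increasing indices. The same \<tau> works for all \<open>x\<close>, as
  is needed when the marks are held fixed and the labels integrated.\<close>

lemma symmetric_kernel_sum:
  assumes y: "inj_on y {1..n}"
  shows "\<exists>\<tau>\<in>perms n. \<forall>x. (\<Sum>i\<in>tuples k n. symmetric_kernel Q k \<sigma> (\<lambda>a. (x (i a), y (i a)))) =
    label_count Q k \<sigma> n (\<lambda>v. x (\<tau> v))"
proof -
  let ?K = "{1..k}"
  \<comment> \<open>Sorting is by decreasing label, so the marks enter with a minus sign.\<close>
  obtain \<tau> where \<tau>: "\<tau> \<in> perms n" and s: "sorts (\<lambda>a b. a \<ge> b) n \<tau> (\<lambda>v. - y v)"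
    using sorts_exists[of "\<lambda>a b. a \<ge> b" n "\<lambda>v. - y v"] by blast
  have tp: "\<tau> permutes {1..n}" using \<tau> by (simp add: perms_def)
  note ti = permutes_in_image[OF tp] permutes_in_image[OF permutes_inv[OF tp]]
  have less: "y (\<tau> u) < y (\<tau> v) \<longleftrightarrow> u < v" if uv: "u \<in> {1..n}" "v \<in> {1..n}" for u v
  proof -
    have "prec (\<lambda>a b. a \<ge> b) (\<lambda>v. - y v) (\<tau> u) (\<tau> v) \<longleftrightarrow> u < v"
      by (rule sorts_iff[OF _ s uv]) simp
    moreover have "y (\<tau> u) = y (\<tau> v) \<longleftrightarrow> \<tau> u = \<tau> v"
      using y ti(1) uv by (simp only: inj_on_eq_iff)
    ultimately show ?thesis by (auto simp: prec_ge_iff)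
  qed
  have "(\<Sum>i\<in>tuples k n. symmetric_kernel Q k \<sigma> (\<lambda>a. (x (i a), y (i a)))) =
    label_count Q k \<sigma> n (\<lambda>v. x (\<tau> v))" for x
    unfolding label_count_def
  proof (rule sum.reindex_bij_witness[of _ "\<lambda>j. \<lambda>a\<in>?K. \<tau> (j a)" "\<lambda>i. \<lambda>a\<in>?K. inv \<tau> (i a)"])
    fix i assume i: "i \<in> tuples k n"
    show "(\<lambda>a\<in>?K. inv \<tau> (i a)) \<in> tuples k n"
      unfolding restrict_PiE_iff using i ti(2) by blast
    show "(\<lambda>a\<in>?K. \<tau> ((\<lambda>a\<in>?K. inv \<tau> (i a)) a)) = i"
    proof
      fix a show "(\<lambda>a\<in>?K. \<tau> ((\<lambda>a\<in>?K. inv \<tau> (i a)) a)) a = i a"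
        by (cases "a \<in> ?K") (simp_all only: restrict_apply if_True if_False permutes_inverses(1)[OF tp] PiE_arb[OF i] simp_thms)
    qed
    have *: "(y (i a) < y (i b) \<longleftrightarrow> inv \<tau> (i a) < inv \<tau> (i b)) \<and> \<tau> (inv \<tau> (i a)) = i a" if "a \<in> ?K" "b \<in> ?K" for a b
    proof -
      have "inv \<tau> (i a) \<in> {1..n}" "inv \<tau> (i b) \<in> {1..n}" using i that ti(2) by blast+
      from less[OF this] show ?thesis by (simp add: permutes_inverses(1)[OF tp])
    qed
    show "of_bool (\<forall>a\<in>?K. \<forall>b\<in>?K. a < b \<longrightarrow>
        (\<lambda>a\<in>?K. inv \<tau> (i a)) a < (\<lambda>a\<in>?K. inv \<tau> (i a)) b \<and>
        (inv \<sigma> a < inv \<sigma> b \<longleftrightarrow> Q (x (\<tau> ((\<lambda>a\<in>?K. inv \<tau> (i a)) a))) (x (\<tau> ((\<lambda>a\<in>?K. inv \<tau> (i a)) b))))) =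
      symmetric_kernel Q k \<sigma> (\<lambda>a. (x (i a), y (i a)))"
      unfolding symmetric_kernel_def using *
      by (simp cong: ball_cong_simp del: atLeastAtMost_iff One_nat_def)
  next
    fix j assume j: "j \<in> tuples k n"
    show "(\<lambda>a\<in>?K. \<tau> (j a)) \<in> tuples k n"
      unfolding restrict_PiE_iff using j ti(1) by blast
    show "(\<lambda>a\<in>?K. inv \<tau> ((\<lambda>a\<in>?K. \<tau> (j a)) a)) = j"
    proof
      fix a show "(\<lambda>a\<in>?K. inv \<tau> ((\<lambda>a\<in>?K. \<tau> (j a)) a)) a = j a"
        by (cases "a \<in> ?K") (simp_all only: restrict_apply if_True if_False permutes_inverses(2)[OF tp] PiE_arb[OF j] simp_thms)
    qed
  qed
  with \<tau> show ?thesis by blast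
qed

lemma label_count_measurable:
  fixes N :: "'a :: {linorder_topology, second_countable_topology} measure"
  assumes "prob_space N" and N: "sets N = sets borel" and Q: "decreasing_order Q"
  shows "label_count Q k \<sigma> n \<in> borel_measurable (iid_seq.P N)"
proof -
  interpret N: iid_seq N by (intro iid_seq.intro assms)
  have [measurable]: "(\<lambda>x. x i) \<in> borel_measurable N.P" for i
    using N.measurable_coord[of i] by (simp add: measurable_cong_sets[OF refl N])
  note [measurable] = pred_decreasing_order[OF Q] borel_measurable_of_bool
  show ?thesis
    unfolding label_count_def[abs_def] by measurable
qed

lemma symmetric_kernel_measurable:
  fixes N :: "'a :: {linorder_topology, second_countable_topology} measure" and U :: "real measure"
  assumes "prob_space N" "prob_space U" and N: "sets N = sets borel" and U: "sets U = sets borel"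
    and Q: "decreasing_order Q"
  shows "symmetric_kernel Q k \<sigma> \<in> borel_measurable (iid_seq.P (N \<Otimes>\<^sub>M U))"
proof -
  interpret N: prob_space N by fact
  interpret U: prob_space U by fact
  interpret NU: pair_prob_space N U ..
  interpret Z: iid_seq "N \<Otimes>\<^sub>M U" by (intro iid_seq.intro NU.prob_space_axioms)
  have "(\<lambda>z. fst (z i)) \<in> measurable Z.P N" "(\<lambda>z. snd (z i)) \<in> measurable Z.P U" for i
    by (auto intro: measurable_compose[OF Z.measurable_coord])
  then have [measurable]: "(\<lambda>z. fst (z i)) \<in> borel_measurable Z.P" "(\<lambda>z. snd (z i)) \<in> borel_measurable Z.P" for i
    by (simp_all add: measurable_cong_sets[OF refl N] measurable_cong_sets[OF refl U])
  note [measurable] = pred_decreasing_order[OF Q] borel_measurable_of_bool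
  show ?thesis
    unfolding symmetric_kernel_def[abs_def] by measurable
qed

lemma symmetric_kernel_depends_on: "depends_on {1..k} (symmetric_kernel Q k \<sigma>)"
  unfolding depends_on_def
proof (intro allI impI)
  fix z z' :: "nat \<Rightarrow> 'a \<times> real" assume "\<forall>a\<in>{1..k}. z a = z' a"
  then have e: "z a = z' a" if "a \<in> {1..k}" for a
    using that by blast
  show "symmetric_kernel Q k \<sigma> z = symmetric_kernel Q k \<sigma> z'"
    unfolding symmetric_kernel_def
    by (intro arg_cong[where f = of_bool] ball_cong refl) (simp only: e)
qed

text \<open>Resampling one coordinate against all others makes it hit a given other coordinate with
  probability 0; there are countably many pairs.\<close>

lemma AE_inj_on_iid:
  fixes U :: "real measure"
  assumes "prob_space U" and U: "sets U = sets borel" and atomless: "\<And>y. emeasure U {y} = 0"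
  shows "AE y in iid_seq.P U. inj y"
proof -
  interpret U: iid_seq U by (intro iid_seq.intro assms)
  interpret UP: pair_prob_space U U.P ..
  have coord: "(\<lambda>x. x i) \<in> borel_measurable U.P" for i
    using U.measurable_coord[of i] by (simp add: measurable_cong_sets[OF refl U])
  have ident: "(\<lambda>x. x) \<in> borel_measurable U"
    by (simp add: measurable_cong_sets[OF U refl])
  have ne: "AE y in U.P. y u \<noteq> y v" if "u \<noteq> v" for u v
  proof -
    have "AE y in distr (U \<Otimes>\<^sub>M U.P) U.P (\<lambda>(x, w). w(u := x)). y u \<noteq> y v"
    proof (subst AE_distr_iff[OF U.measurable_upd])
      show "{y \<in> space U.P. y u \<noteq> y v} \<in> sets U.P"
        by (intro borel_measurable_neq coord)
      have m: "{z \<in> space (U \<Otimes>\<^sub>M U.P). fst z \<noteq> snd z v} \<in> sets (U \<Otimes>\<^sub>M U.P)"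
        by (intro borel_measurable_neq measurable_compose[OF measurable_fst ident]
            measurable_compose[OF measurable_snd coord])
      have "AE w in U.P. AE x in U. x \<noteq> w v"
      proof (rule AE_I2)
        fix w
        show "AE x in U. x \<noteq> w v"
          using atomless[of "w v"] by (intro AE_I[of _ _ "{w v}"]) (auto simp: U)
      qed
      then have "AE z in U \<Otimes>\<^sub>M U.P. fst z \<noteq> snd z v"
        unfolding UP.AE_commute[OF m, symmetric] UP.AE_pair_iff[OF m] .
      then show "AE z in U \<Otimes>\<^sub>M U.P. (case z of (x, w) \<Rightarrow> w(u := x)) u \<noteq> (case z of (x, w) \<Rightarrow> w(u := x)) v"
        using that by (auto simp: case_prod_unfold)
    qed
    then show ?thesis unfolding U.distr_upd .
  qed
  have "AE y in U.P. \<forall>u v. u \<noteq> v \<longrightarrow> y u \<noteq> y v"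
    using ne by (simp add: AE_all_countable)
  then show ?thesis
    by eventually_elim (auto simp: inj_def)
qed

text \<open>Integrate over the marks last. For almost every sequence of marks the sum is the label
  count of labels permuted by a fixed \<tau>, and exchangeability of the labels gives it the law on
  the right; the outer integrand is therefore constant.\<close>

lemma distr_symmetric_sum:
  fixes N :: "'a :: {linorder_topology, second_countable_topology} measure" and U :: "real measure"
  assumes N: "prob_space N" "sets N = sets borel" and U: "prob_space U" "sets U = sets borel"
    and atomless: "\<And>y. emeasure U {y} = 0" and Q: "decreasing_order Q"
  shows "distr (iid_seq.P (N \<Otimes>\<^sub>M U)) borel
      (\<lambda>z. \<Sum>i\<in>tuples k n. symmetric_kernel Q k \<sigma> (\<lambda>a. z (i a))) =
    distr (iid_seq.P N) borel (label_count Q k \<sigma> n)" (is "distr ?Z borel ?W = ?R")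
proof -
  interpret N: iid_seq N by (intro iid_seq.intro assms)
  interpret U: iid_seq U by (intro iid_seq.intro assms)
  interpret NU: pair_prob_space N U ..
  interpret Z: iid_seq "N \<Otimes>\<^sub>M U" by (intro iid_seq.intro NU.prob_space_axioms)
  interpret XY: pair_prob_space N.P U.P ..
  note L = label_count_measurable[OF N Q, of k \<sigma> n]
  let ?pair = "\<lambda>(x, y) i. (x i, y i)"
  have pm: "?pair \<in> measurable (N.P \<Otimes>\<^sub>M U.P) Z.P"
    unfolding case_prod_unfold
    by (intro Z.measurable_into_P measurable_Pair measurable_compose[OF measurable_fst N.measurable_coord]
        measurable_compose[OF measurable_snd U.measurable_coord])
  have W: "?W \<in> borel_measurable Z.P"
    by (rule borel_measurable_sum,
        rule measurable_compose[OF Z.measurable_reindex symmetric_kernel_measurable[OF N(1) U(1) N(2) U(2) Q]])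
  show ?thesis
  proof (rule measure_eqI)
    fix A assume "A \<in> sets (distr Z.P borel ?W)"
    then have A: "A \<in> sets borel" by simp
    define B where "B = (\<lambda>z. ?W (?pair z)) -` A \<inter> space (N.P \<Otimes>\<^sub>M U.P)"
    have Wp: "(\<lambda>z. ?W (?pair z)) \<in> borel_measurable (N.P \<Otimes>\<^sub>M U.P)"
      by (rule measurable_compose[OF pm W])
    have B: "B \<in> sets (N.P \<Otimes>\<^sub>M U.P)"
      unfolding B_def by (rule measurable_sets[OF Wp A])
    have "distr Z.P borel ?W = distr (N.P \<Otimes>\<^sub>M U.P) borel (\<lambda>z. ?W (?pair z))"
      by (subst distr_pair_sequences[OF N(1) U(1), symmetric]) (simp only: distr_distr[OF W pm] o_def)
    then have "emeasure (distr Z.P borel ?W) A = emeasure (distr (N.P \<Otimes>\<^sub>M U.P) borel (\<lambda>z. ?W (?pair z))) A"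
      by (rule arg_cong)
    also have "\<dots> = emeasure (N.P \<Otimes>\<^sub>M U.P) B"
      unfolding B_def by (rule emeasure_distr[OF Wp A])
    also have "\<dots> = (\<integral>\<^sup>+y. emeasure N.P ((\<lambda>x. (x, y)) -` B) \<partial>U.P)"
      by (rule XY.emeasure_pair_measure_alt2[OF B])
    also have "\<dots> = (\<integral>\<^sup>+y. emeasure ?R A \<partial>U.P)"
    proof (rule nn_integral_cong_AE)
      show "AE y in U.P. emeasure N.P ((\<lambda>x. (x, y)) -` B) = emeasure ?R A"
        using AE_inj_on_iid[OF U atomless] AE_space
      proof eventually_elim
        case (elim y)
        then have "inj_on y {1..n}" by (auto intro: inj_on_subset)
        from symmetric_kernel_sum[OF this, where k = k and Q = Q and \<sigma> = \<sigma>] obtain \<tau> where \<tau>: "\<tau> \<in> perms n"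
          and eq: "\<And>x. (\<Sum>i\<in>tuples k n. symmetric_kernel Q k \<sigma> (\<lambda>a. (x (i a), y (i a)))) =
            label_count Q k \<sigma> n (\<lambda>v. x (\<tau> v))" by blast
        have "inj_on \<tau> {1..n}"
          using \<tau> permutes_inj_on by (auto simp: perms_def)
        then have "?R = distr N.P borel (\<lambda>x. label_count Q k \<sigma> n (\<lambda>v. x (\<tau> v)))"
          by (rule N.distr_reindex[OF L label_count_depends_on, symmetric])
        moreover have "(\<lambda>x. (x, y)) -` B = (\<lambda>x. label_count Q k \<sigma> n (\<lambda>v. x (\<tau> v))) -` A \<inter> space N.P"
          using elim unfolding B_def by (auto simp: space_pair_measure eq[unfolded One_nat_def])
        ultimately show ?case
          by (simp add: emeasure_distr[OF measurable_compose[OF N.measurable_reindex L] A])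
      qed
    qed
    also have "\<dots> = emeasure ?R A"
      by (simp add: U.seq.emeasure_space_1)
    finally show "emeasure (distr Z.P borel ?W) A = emeasure ?R A" .
  qed simp
qed

section \<open>Probabilities of decreasing label sequences\<close>

definition chain :: "nat set \<Rightarrow> nat \<Rightarrow> (nat \<Rightarrow> 'a::linorder) \<Rightarrow> bool" where
  "chain D n x \<longleftrightarrow> (\<forall>i\<in>{1..<n}. if i \<in> D then x i > x (i + 1) else x i \<ge> x (i + 1))"

lemma chain_Suc:
  "chain D (Suc n) x \<longleftrightarrow> chain D n x \<and> (n \<ge> 1 \<longrightarrow> (if n \<in> D then x n > x (Suc n) else x n \<ge> x (Suc n)))"
proof (cases "n = 0")
  case False
  then have eq: "{1..<Suc n} = insert n {1..<n}" by auto
  show ?thesis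
    unfolding chain_def eq ball_simps unfolding Suc_eq_plus1 using False by (simp add: conj_commute del: One_nat_def)
qed (simp add: chain_def)

lemma chain_cong: "(\<And>i. i \<in> {1..n} \<Longrightarrow> x i = y i) \<Longrightarrow> chain D n x \<longleftrightarrow> chain D n y"
  unfolding chain_def by (intro ball_cong refl) auto

locale label_seq = iid_seq N for N :: "'a :: {linorder_topology, second_countable_topology} measure" +
  assumes sets_N: "sets N = sets borel"
begin

lemma borel_coord [measurable]: "(\<lambda>x. x i) \<in> borel_measurable P"
  using measurable_coord[of i] by (simp add: measurable_cong_sets[OF refl sets_N])

lemma space_N: "space N = UNIV"
  using sets_eq_imp_space_eq[OF sets_N] by simp

lemma space_P_UNIV: "space P = UNIV"
  by (simp add: space_P space_N)

lemma pred_chain [measurable]: "Measurable.pred P (chain D n)"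
proof -
  have "Measurable.pred P (\<lambda>x. if i \<in> D then x i > x (i + 1) else x i \<ge> x (i + 1))" for i
    using borel_measurable_less[OF borel_coord[of "i + 1"] borel_coord[of i]]
      borel_measurable_le[OF borel_coord[of "i + 1"] borel_coord[of i]]
    by (cases "i \<in> D") (simp_all add: pred_def)
  then show ?thesis
    unfolding chain_def[abs_def] by (intro pred_intros_finite) auto
qed

lemma emeasure_resample:
  assumes A: "A \<in> sets P"
  shows "emeasure P A = (\<integral>\<^sup>+z. emeasure P {w. w(v := z) \<in> A} \<partial>N)"
proof -
  have m: "(\<lambda>(x, w). w(v := x)) -` A \<inter> space (N \<Otimes>\<^sub>M P) \<in> sets (N \<Otimes>\<^sub>M P)"
    by (rule measurable_sets[OF measurable_upd A])
  have "emeasure P A = emeasure (distr (N \<Otimes>\<^sub>M P) P (\<lambda>(x, w). w(v := x))) A"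
    by (simp only: distr_upd)
  also have "\<dots> = emeasure (N \<Otimes>\<^sub>M P) ((\<lambda>(x, w). w(v := x)) -` A \<inter> space (N \<Otimes>\<^sub>M P))"
    by (rule emeasure_distr[OF measurable_upd A])
  also have "\<dots> = (\<integral>\<^sup>+z. emeasure P (Pair z -` ((\<lambda>(x, w). w(v := x)) -` A \<inter> space (N \<Otimes>\<^sub>M P))) \<partial>N)"
    by (rule seq.emeasure_pair_measure_alt[OF m])
  also have "\<dots> = (\<integral>\<^sup>+z. emeasure P {w. w(v := z) \<in> A} \<partial>N)"
    by (intro nn_integral_cong arg_cong[where f = "emeasure P"])
       (auto simp: space_pair_measure space_P_UNIV space_N)
  finally show ?thesis .
qed

text \<open>Condition on the last label z. It must satisfy \<open>B\<close>, and the shorter chain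
  must end above it, strictly or weakly as \<open>D\<close> prescribes at n. This is the recursion
  behind both explicit computations below.\<close>

lemma emeasure_chain_Suc:
  assumes B: "Measurable.pred borel B"
  shows "emeasure P {x. chain D (Suc n) x \<and> B (x (Suc n))} =
    (\<integral>\<^sup>+z. indicator {z. B z} z * emeasure P {x. chain D n x \<and> (n \<ge> 1 \<longrightarrow> (if n \<in> D then x n > z else x n \<ge> z))} \<partial>N)"
proof -
  have "{x \<in> space P. chain D (Suc n) x \<and> B (x (Suc n))} \<in> sets P"
    using measurable_compose[OF borel_coord B] by measurable
  then have A: "{x. chain D (Suc n) x \<and> B (x (Suc n))} \<in> sets P"
    by (simp add: space_P_UNIV)
  have eq: "{w. w(Suc n := z) \<in> {x. chain D (Suc n) x \<and> B (x (Suc n))}} =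
      (if B z then {x. chain D n x \<and> (n \<ge> 1 \<longrightarrow> (if n \<in> D then x n > z else x n \<ge> z))} else {})" for z
  proof -
    have "chain D n (w(Suc n := z)) \<longleftrightarrow> chain D n w" for w
      by (rule chain_cong) auto
    then show ?thesis by (auto simp: chain_Suc)
  qed
  show ?thesis
    unfolding emeasure_resample[OF A, of "Suc n"] eq
    by (intro nn_integral_cong) (auto simp: indicator_def)
qed

end

section \<open>Explicit chain probabilities for geometric and uniform labels\<close>

lemma label_seq_geometric: "label_seq (measure_pmf (geometric_pmf p))"
  by (intro label_seq.intro iid_seq.intro label_seq_axioms.intro measure_pmf.prob_space_axioms)
     (simp add: sets_borel_eq_count_space)

lemma label_seq_uniform: "label_seq (uniform_measure lborel {0..1 :: real})"
  by (intro label_seq.intro iid_seq.intro label_seq_axioms.intro prob_space_uniform_measure) simp_all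

text \<open>The threshold m on the last and smallest label makes the induction close. By
  memorylessness it costs r ^ m for each of the n labels, and a strict drop at n raises the
  threshold by one, which costs r ^ n. Summing over the new last label gives a geometric series of
  ratio r ^ (n + 1), the source of the denominators.\<close>

lemma geometric_chain:
  fixes r :: real
  assumes r: "0 < r" "r < 1"
  shows "emeasure (iid_seq.P (measure_pmf (geometric_pmf (1 - r)))) {x. chain D n x \<and> (n \<ge> 1 \<longrightarrow> x n \<ge> m)} =
    ennreal (r ^ (\<Sum>i\<in>D \<inter> {1..<n}. i) * (\<Prod>i=1..n. (1 - r) / (1 - r ^ i)) * r ^ (n * m))"
proof -
  let ?N = "measure_pmf (geometric_pmf (1 - r))"
  interpret N: label_seq ?N by (rule label_seq_geometric)
  define c where "c n = r ^ (\<Sum>i\<in>D \<inter> {1..<n}. i) * (\<Prod>i=1..n. (1 - r) / (1 - r ^ i))" for n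
  have c0: "c n \<ge> 0" for n
  proof -
    have "0 \<le> (1 - r) / (1 - r ^ i)" for i
      using r by (simp add: power_le_one)
    then show ?thesis unfolding c_def using r by (simp add: prod_nonneg)
  qed
  have c_Suc: "c (Suc n) = c n * (if n \<in> D then r ^ n else 1) * ((1 - r) / (1 - r ^ Suc n))" for n
  proof -
    have "(\<Sum>i\<in>D \<inter> {1..<Suc n}. i) = (\<Sum>i\<in>D \<inter> {1..<n}. i) + (if n \<in> D then n else 0)"
    proof (cases "n \<in> D \<and> n \<ge> 1")
      case True
      then have "D \<inter> {1..<Suc n} = insert n (D \<inter> {1..<n})" by auto
      then show ?thesis using True by simp
    next
      case False
      then have "n \<notin> D \<or> n = 0" by auto
      moreover have "D \<inter> {1..<Suc n} = D \<inter> {1..<n}" using False by (auto simp: less_Suc_eq)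
      ultimately show ?thesis by auto
    qed
    then show ?thesis by (simp add: c_def power_add)
  qed
  have "emeasure N.P {x. chain D n x \<and> (n \<ge> 1 \<longrightarrow> x n \<ge> m)} = ennreal (c n * r ^ (n * m))" for m
  proof (induction n arbitrary: m)
    case 0
    have "emeasure N.P {x. True} = 1"
      using N.seq.emeasure_space_1 by (simp add: N.space_P_UNIV)
    then show ?case by (simp add: chain_def c_def)
  next
    case (Suc n)
    \<comment> \<open>For natural numbers x n > z means x n \<ge> z + 1, which brings both kinds of
      step under the weak induction hypothesis.\<close>
    let ?e = "if n \<in> D then 1 else 0 :: nat"
    have step: "emeasure N.P {x. chain D n x \<and> (n \<ge> 1 \<longrightarrow> (if n \<in> D then x n > z else x n \<ge> z))} =
        ennreal (c n * r ^ (n * (z + ?e)))" for z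
      using Suc[of "z + ?e"] by (cases "n \<in> D") (auto simp: Suc_le_eq)
    have "emeasure N.P {x. chain D (Suc n) x \<and> (Suc n \<ge> 1 \<longrightarrow> x (Suc n) \<ge> m)} =
        (\<integral>\<^sup>+z. indicator {z. z \<ge> m} z * ennreal (c n * r ^ (n * (z + ?e))) \<partial>?N)"
    proof -
      have "Measurable.pred borel (\<lambda>z :: nat. z \<ge> m)" by measurable
      from N.emeasure_chain_Suc[OF this, of D n] show ?thesis
        unfolding step by simp
    qed
    also have "\<dots> = (\<integral>\<^sup>+z. ennreal (pmf (geometric_pmf (1 - r)) z) *
        (indicator {z. z \<ge> m} z * ennreal (c n * r ^ (n * (z + ?e)))) \<partial>count_space UNIV)"
      by (rule nn_integral_measure_pmf)
    also have "\<dots> = (\<Sum>z. ennreal (if z \<ge> m then r ^ z * (1 - r) * (c n * r ^ (n * (z + ?e))) else 0))"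
      unfolding nn_integral_count_space_nat using r c0
      by (intro suminf_cong) (auto simp: indicator_def ennreal_mult'[symmetric])
    also have "\<dots> = ennreal (c (Suc n) * r ^ (Suc n * m))"
    proof (rule suminf_ennreal_eq)
      show "0 \<le> (if z \<ge> m then r ^ z * (1 - r) * (c n * r ^ (n * (z + ?e))) else 0)" for z
        using r c0 by auto
      have rn: "r ^ Suc n < 1" using r by (intro power_Suc_less_one) auto
      have "(\<lambda>z. (r ^ Suc n) ^ z) sums (1 / (1 - r ^ Suc n))"
        by (rule geometric_sums) (use r rn in simp)
      then have "(\<lambda>z. (1 - r) * c n * r ^ (n * ?e) * (r ^ Suc n) ^ m * (r ^ Suc n) ^ z) sums
          ((1 - r) * c n * r ^ (n * ?e) * (r ^ Suc n) ^ m * (1 / (1 - r ^ Suc n)))"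
        by (rule sums_mult)
      also have "(\<lambda>z. (1 - r) * c n * r ^ (n * ?e) * (r ^ Suc n) ^ m * (r ^ Suc n) ^ z) =
          (\<lambda>z. r ^ (z + m) * (1 - r) * (c n * r ^ (n * ((z + m) + ?e))))"
        by (rule ext) (simp add: power_mult[symmetric] power_add algebra_simps)
      finally have "(\<lambda>z. (if z + m \<ge> m then r ^ (z + m) * (1 - r) * (c n * r ^ (n * ((z + m) + ?e))) else 0)) sums
          ((1 - r) * c n * r ^ (n * ?e) * (r ^ Suc n) ^ m * (1 / (1 - r ^ Suc n)))"
        by simp
      then have "(\<lambda>z. if z \<ge> m then r ^ z * (1 - r) * (c n * r ^ (n * (z + ?e))) else 0) sums
          ((1 - r) * c n * r ^ (n * ?e) * (r ^ Suc n) ^ m * (1 / (1 - r ^ Suc n)))"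
        using sums_zero_iff_shift[of m "\<lambda>z. if z \<ge> m then r ^ z * (1 - r) * (c n * r ^ (n * (z + ?e))) else 0"]
        by simp
      also have "(1 - r) * c n * r ^ (n * ?e) * (r ^ Suc n) ^ m * (1 / (1 - r ^ Suc n)) = c (Suc n) * r ^ (Suc n * m)"
        by (simp add: c_Suc power_mult[symmetric] del: power_Suc)
      finally show "(\<lambda>z. if z \<ge> m then r ^ z * (1 - r) * (c n * r ^ (n * (z + ?e))) else 0) sums
          (c (Suc n) * r ^ (Suc n * m))" .
    qed
    finally show ?case .
  qed
  then show ?thesis by (simp add: c_def)
qed

text \<open>The value is the volume of the decreasing sequences in [m, 1], that is 1 / n! of a cube
  of side 1 - m; ties are null. Both versions are proved together, since the induction step calls
  for either one according to whether the step at n is strict.\<close>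

lemma uniform_chain:
  assumes "0 \<le> m" "m \<le> 1"
  shows "emeasure (iid_seq.P (uniform_measure lborel {0..1})) {x. chain D n x \<and> (n \<ge> 1 \<longrightarrow> x n \<ge> m)} =
      ennreal ((1 - m) ^ n / fact n)"
    and "emeasure (iid_seq.P (uniform_measure lborel {0..1})) {x. chain D n x \<and> (n \<ge> 1 \<longrightarrow> x n > m)} =
      ennreal ((1 - m) ^ n / fact n)"
proof -
  let ?N = "uniform_measure lborel {0..1 :: real}"
  interpret N: label_seq ?N by (rule label_seq_uniform)
  have "emeasure N.P {x. chain D n x \<and> (n \<ge> 1 \<longrightarrow> x n \<ge> m)} = ennreal ((1 - m) ^ n / fact n) \<and>
    emeasure N.P {x. chain D n x \<and> (n \<ge> 1 \<longrightarrow> x n > m)} = ennreal ((1 - m) ^ n / fact n)"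
    using assms
  proof (induction n arbitrary: m)
    case 0
    have "emeasure N.P {x. True} = 1"
      using N.seq.emeasure_space_1 by (simp add: N.space_P_UNIV)
    then show ?case by (simp add: chain_def)
  next
    case (Suc n)
    define g where "g z = emeasure N.P {x. chain D n x \<and> (n \<ge> 1 \<longrightarrow> (if n \<in> D then x n > z else x n \<ge> z))}" for z
    have step: "g z = ennreal ((1 - z) ^ n / fact n)" if "0 \<le> z" "z \<le> 1" for z
      using Suc.IH[OF that] unfolding g_def by (cases "n \<in> D") simp_all
    \<comment> \<open>\<open>B\<close> stands for both thresholds, weak and strict, which differ
      only at the null point m.\<close>
    have main: "emeasure N.P {x. chain D (Suc n) x \<and> B (x (Suc n))} = ennreal ((1 - m) ^ Suc n / fact (Suc n))"
      if B: "Measurable.pred borel B" and Bm: "\<And>z. z \<noteq> m \<Longrightarrow> B z \<longleftrightarrow> z > m" for B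
    proof -
      have "emeasure N.P {x. chain D (Suc n) x \<and> B (x (Suc n))} = (\<integral>\<^sup>+z. indicator {z. B z} z * g z \<partial>?N)"
        unfolding g_def by (rule N.emeasure_chain_Suc[OF B])
      also have "\<dots> = (\<integral>\<^sup>+z. ennreal (if m \<le> z then (1 - z) ^ n / fact n else 0) \<partial>?N)"
      proof (rule nn_integral_cong_AE)
        have "AE z in lborel. z \<noteq> m"
          by (rule AE_lborel_singleton)
        then show "AE z in ?N. indicator {z. B z} z * g z = ennreal (if m \<le> z then (1 - z) ^ n / fact n else 0)"
          by (subst AE_uniform_measure) (auto elim!: eventually_mono simp: step Bm indicator_def)
      qed
      also have "\<dots> = (\<integral>\<^sup>+z. ennreal ((1 - z) ^ n / fact n) * indicator {m..1} z \<partial>lborel)"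
        by (subst nn_integral_uniform_measure)
           (use Suc.prems in \<open>auto intro!: nn_integral_cong simp: indicator_def divide_ennreal_def\<close>)
      also have "\<dots> = ennreal (- ((1 - 1) ^ Suc n / fact (Suc n)) - - ((1 - m) ^ Suc n / fact (Suc n)))"
      proof (rule nn_integral_FTC_Icc[where F = "\<lambda>z. - ((1 - z) ^ Suc n / fact (Suc n))"])
        fix x assume x: "x \<in> {m..1}"
        show "((\<lambda>z. - ((1 - z) ^ Suc n / fact (Suc n))) has_real_derivative (1 - x) ^ n / fact n) (at x)"
        proof -
          have "((\<lambda>z. - ((1 - z) ^ Suc n / fact (Suc n))) has_real_derivative
              real (Suc n) * (1 - x) ^ n / fact (Suc n)) (at x)"
            by (auto intro!: derivative_eq_intros simp del: of_nat_Suc fact_Suc power_Suc)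
          then show ?thesis by (simp del: of_nat_Suc power_Suc)
        qed
        show "0 \<le> (1 - x) ^ n / fact n" using x by simp
      qed (use Suc.prems in auto)
      finally show ?thesis by simp
    qed
    show ?case
    proof -
      have B: "Measurable.pred borel (\<lambda>z. z \<ge> m)" "Measurable.pred borel (\<lambda>z. z > m)"
        by measurable
      have "z \<noteq> m \<Longrightarrow> z \<ge> m \<longleftrightarrow> z > m" for z
        by auto
      from main[OF B(1) this] main[OF B(2)] show ?thesis by simp
    qed
  qed
  then show "emeasure N.P {x. chain D n x \<and> (n \<ge> 1 \<longrightarrow> x n \<ge> m)} = ennreal ((1 - m) ^ n / fact n)"
    and "emeasure N.P {x. chain D n x \<and> (n \<ge> 1 \<longrightarrow> x n > m)} = ennreal ((1 - m) ^ n / fact n)"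
    by blast+
qed

section \<open>The Maj distribution\<close>

lemma sorts_ge_iff_chain:
  assumes "p \<in> perms n"
  shows "sorts (\<lambda>a b. a \<ge> b) n p x \<longleftrightarrow> chain {i \<in> {1..<n}. p i > p (i + 1)} n (\<lambda>i. x (p i))"
proof -
  have ne: "p i \<noteq> p (i + 1)" for i
    using assms by (simp add: perms_def inj_eq[OF permutes_inj])
  show ?thesis
    unfolding sorts_def chain_def
  proof (intro ball_cong refl)
    fix i assume "i \<in> {1..<n}"
    then show "prec (\<lambda>a b. a \<ge> b) x (p i) (p (i + 1)) \<longleftrightarrow> (if i \<in> {i \<in> {1..<n}. p i > p (i + 1)}
        then x (p i) > x (p (i + 1)) else x (p i) \<ge> x (p (i + 1)))"
      unfolding prec_def using ne[of i] by (cases "p i" "p (i + 1)" rule: linorder_cases) auto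
  qed
qed

lemma sorts_gt_iff_chain:
  assumes "p \<in> perms n"
  shows "sorts (\<lambda>a b. a > b) n p x \<longleftrightarrow> chain {i \<in> {1..<n}. p i < p (i + 1)} n (\<lambda>i. x (p i))"
proof -
  have ne: "p i \<noteq> p (i + 1)" for i
    using assms by (simp add: perms_def inj_eq[OF permutes_inj])
  show ?thesis
    unfolding sorts_def chain_def
  proof (intro ball_cong refl)
    fix i assume "i \<in> {1..<n}"
    then show "prec (\<lambda>a b. a > b) x (p i) (p (i + 1)) \<longleftrightarrow> (if i \<in> {i \<in> {1..<n}. p i < p (i + 1)}
        then x (p i) > x (p (i + 1)) else x (p i) \<ge> x (p (i + 1)))"
      unfolding prec_def using ne[of i] by (cases "p i" "p (i + 1)" rule: linorder_cases) auto
  qed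
qed

lemma chain_depends_on: "depends_on {1..n} (chain D n)"
  unfolding depends_on_def
proof (intro allI impI)
  fix x y :: "nat \<Rightarrow> 'a" assume "\<forall>i\<in>{1..n}. x i = y i"
  then show "chain D n x = chain D n y" by (intro chain_cong) blast
qed

lemma q_int_eq: "q \<noteq> 1 \<Longrightarrow> q_int q n = (1 - q ^ n) / (1 - q)"
  unfolding q_int_def by (subst sum_gp_strict) auto

lemma q_int_pos: "q > 0 \<Longrightarrow> n \<ge> 1 \<Longrightarrow> q_int q n > 0"
  unfolding q_int_def by (intro sum_pos) (auto simp: lessThan_empty_iff)

lemma q_fact_pos: "q > 0 \<Longrightarrow> q_fact q n > 0"
  unfolding q_fact_def by (intro prod_pos) (auto intro: q_int_pos)

text \<open>Read the geometric sum backwards. Needed to pass from labels of ratio 1 / q back to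
  q.\<close>

lemma q_int_inverse:
  assumes "q > 0" "n \<ge> 1"
  shows "q_int q n = q ^ (n - 1) * q_int (1 / q) n"
proof -
  have "q_int q n = (\<Sum>i<n. q ^ (n - Suc i))"
    unfolding q_int_def by (rule sum.nat_diff_reindex[symmetric])
  also have "\<dots> = (\<Sum>i<n. q ^ (n - 1) * (1 / q) ^ i)"
  proof (rule sum.cong[OF refl])
    fix i assume "i \<in> {..<n}"
    then have "n - 1 = (n - Suc i) + i" by auto
    then have "q ^ (n - 1) = q ^ (n - Suc i) * q ^ i" by (metis power_add)
    then show "q ^ (n - Suc i) = q ^ (n - 1) * (1 / q) ^ i"
      using assms by (simp add: power_divide)
  qed
  finally show ?thesis by (simp add: q_int_def sum_distrib_left)
qed

lemma prod_one_minus_power: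
  assumes "r \<noteq> 1"
  shows "(\<Prod>i=1..n. (1 - r) / (1 - r ^ i)) = 1 / q_fact r n"
proof -
  have "(1 - r) / (1 - r ^ i) = 1 / q_int r i" for i
    using assms by (simp add: q_int_eq)
  then show ?thesis by (simp add: q_fact_def prod_dividef)
qed

text \<open>Every position is an ascent or a descent. The total n (n - 1) / 2 is written as a sum of
  i - 1 to match the powers of q produced by \<open>q_int_inverse\<close>.\<close>

lemma ascent_sum:
  assumes "p \<in> perms n"
  shows "(\<Sum>i | i \<in> {1..<n} \<and> p i < p (i + 1). i) + maj n p = (\<Sum>i=1..n. i - 1)"
proof -
  have ne: "p i \<noteq> p (i + 1)" for i
    using assms by (simp add: perms_def inj_eq[OF permutes_inj])
  have "(\<Sum>i | i \<in> {1..<n} \<and> p i < p (i + 1). i) + maj n p =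
      (\<Sum>i\<in>{i \<in> {1..<n}. p i < p (i + 1)} \<union> {i \<in> {1..<n}. p i > p (i + 1)}. i)"
    unfolding maj_def by (rule sum.union_disjoint[symmetric]) auto
  also have "{i \<in> {1..<n}. p i < p (i + 1)} \<union> {i \<in> {1..<n}. p i > p (i + 1)} = {1..<n}"
    using ne by (auto simp: neq_iff)
  also have "(\<Sum>i\<in>{1..<n}. i) = (\<Sum>i\<in>{0..<n}. i)"
    by (rule sum.mono_neutral_left) auto
  also have "\<dots> = (\<Sum>i=1..n. i - 1)"
    by (rule sum.reindex_bij_witness[of _ "\<lambda>i. i - 1" Suc]) auto
  finally show ?thesis .
qed

text \<open>The interface between the label law and the limit theorem: the probability of each
  sorting event. The cases q < 1, q = 1 and q > 1 are three instances of it.\<close>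

locale label_model = label_seq N for N :: "'a :: {linorder_topology, second_countable_topology} measure" +
  fixes Q :: "'a \<Rightarrow> 'a \<Rightarrow> bool" and q :: real
  assumes Q: "decreasing_order Q" and q: "q > 0"
    and emeasure_sorts: "\<And>n p. p \<in> perms n \<Longrightarrow>
      emeasure P {x. sorts Q n p x} = ennreal (q ^ maj n p / q_fact q n)"
begin

text \<open>A non-measurable set has \<open>emeasure\<close> 0, whereas the prescribed probability
  is positive; measurability is thus a consequence of \<open>emeasure_sorts\<close>.\<close>

lemma sorts_sets: "p \<in> perms n \<Longrightarrow> {x. sorts Q n p x} \<in> sets P"
  using q q_fact_pos[OF q, of n]
  by (intro emeasure_neq_0_sets) (simp add: emeasure_sorts ennreal_eq_0_iff not_le)

lemma finite_perms: "finite (perms n)"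
  unfolding perms_def by (rule finite_permutations) simp

text \<open>The sorting events of different permutations are disjoint by
  \<open>sorts_unique\<close>, so the point masses add up to the measure of their union.\<close>

lemma emeasure_Maj:
  assumes "A \<subseteq> perms n"
  shows "emeasure (Maj n q) A = emeasure P (\<Union>p\<in>A. {x. sorts Q n p x})"
proof -
  have fin: "finite A" using assms finite_perms finite_subset by blast
  have "emeasure (Maj n q) A = (\<Sum>p\<in>A. ennreal (q ^ maj n p / q_fact q n))"
    unfolding Maj_def by (rule emeasure_point_measure_finite[OF finite_perms assms])
  also have "\<dots> = (\<Sum>p\<in>A. emeasure P {x. sorts Q n p x})"
    by (rule sum.cong) (use assms in \<open>auto simp: emeasure_sorts\<close>)
  also have "\<dots> = emeasure P (\<Union>p\<in>A. {x. sorts Q n p x})"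
  proof (rule sum_emeasure[OF _ _ fin])
    show "(\<lambda>p. {x. sorts Q n p x}) ` A \<subseteq> sets P"
      using assms sorts_sets by blast
    show "disjoint_family_on (\<lambda>p. {x. sorts Q n p x}) A"
      unfolding disjoint_family_on_def using sorts_unique[OF Q] assms by blast
  qed
  finally show ?thesis .
qed

lemma measurable_Maj: "f \<in> borel_measurable (Maj n q)"
  unfolding Maj_def by (simp add: measurable_point_measure_eq1)

lemma distr_pattern_count:
  assumes \<sigma>: "\<sigma> \<in> perms k"
  shows "distr (Maj n q) borel (pattern_count k \<sigma> n) = distr P borel (label_count Q k \<sigma> n)"
proof (rule measure_eqI)
  fix A assume "A \<in> sets (distr (Maj n q) borel (pattern_count k \<sigma> n))"
  then have A: "A \<in> sets borel" by simp
  note L = label_count_measurable[OF prob_space_axioms sets_N Q, of k \<sigma> n]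
  let ?A = "{p \<in> perms n. pattern_count k \<sigma> n p \<in> A}"
  have "emeasure (distr (Maj n q) borel (pattern_count k \<sigma> n)) A = emeasure (Maj n q) ?A"
  proof -
    have "pattern_count k \<sigma> n -` A \<inter> space (Maj n q) = ?A"
      by (auto simp: Maj_def space_point_measure)
    then show ?thesis by (simp add: emeasure_distr[OF measurable_Maj A])
  qed
  also have "\<dots> = emeasure P (\<Union>p\<in>?A. {x. sorts Q n p x})"
    by (rule emeasure_Maj) auto
  also have "(\<Union>p\<in>?A. {x. sorts Q n p x}) = label_count Q k \<sigma> n -` A \<inter> space P"
  proof (intro set_eqI iffI)
    fix x assume "x \<in> (\<Union>p\<in>?A. {x. sorts Q n p x})"
    then obtain p where "p \<in> perms n" "pattern_count k \<sigma> n p \<in> A" "sorts Q n p x" by blast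
    then show "x \<in> label_count Q k \<sigma> n -` A \<inter> space P"
      using label_count_eq_pattern_count[OF Q \<sigma>] by (simp add: space_P_UNIV)
  next
    fix x assume "x \<in> label_count Q k \<sigma> n -` A \<inter> space P"
    moreover obtain p where "p \<in> perms n" "sorts Q n p x" using sorts_exists[OF Q] by blast
    ultimately show "x \<in> (\<Union>p\<in>?A. {x. sorts Q n p x})"
      using label_count_eq_pattern_count[OF Q \<sigma>] by fastforce
  qed
  also have "emeasure P \<dots> = emeasure (distr P borel (label_count Q k \<sigma> n)) A"
    by (rule emeasure_distr[OF L A, symmetric])
  finally show "emeasure (distr (Maj n q) borel (pattern_count k \<sigma> n)) A = \<dots>" .
qed simp

theorem pattern_count_asymptotically_normal:
  assumes k: "k \<ge> 1" and \<sigma>: "\<sigma> \<in> perms k"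
  shows "\<exists>s\<ge>0.
    (\<lambda>n. prob_space.variance (Maj n q) (pattern_count k \<sigma> n) / real n ^ (2 * k - 1)) \<longlonglongrightarrow> s\<^sup>2 \<and>
    weak_conv_m
      (\<lambda>n. distr (Maj n q) borel
         (\<lambda>p. (pattern_count k \<sigma> n p - prob_space.expectation (Maj n q) (pattern_count k \<sigma> n))
               / real n powr (real k - 1 / 2)))
      (centered_normal s)"
proof -
  let ?U = "uniform_measure lborel {0..1 :: real}"
  interpret U: prob_space ?U by (rule prob_space_uniform_measure) simp_all
  have sets_U: "sets ?U = sets borel" by simp
  have atomless: "emeasure ?U {y} = 0" for y
  proof -
    have "emeasure lborel ({0..1} \<inter> {y}) \<le> emeasure lborel {y}" by (rule emeasure_mono) auto
    then show ?thesis by simp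
  qed
  interpret NU: pair_prob_space N ?U ..
  interpret Z: iid_seq "N \<Otimes>\<^sub>M ?U" by (intro iid_seq.intro NU.prob_space_axioms)
  define W where "W n z = (\<Sum>i\<in>tuples k n. symmetric_kernel Q k \<sigma> (\<lambda>a. z (i a)))" for n and z :: "nat \<Rightarrow> 'a \<times> real"
  note K = symmetric_kernel_measurable[OF prob_space_axioms U.prob_space_axioms sets_N sets_U Q, of k \<sigma>]
  have W [measurable]: "W n \<in> borel_measurable Z.P" for n
    unfolding W_def by (rule borel_measurable_sum, rule measurable_compose[OF Z.measurable_reindex K])
  \<comment> \<open>Mean, variance and normalised law depend only on this image measure, so
    everything is transferred from the symmetric sum without a coupling of the two spaces.\<close>
  have law: "distr (Maj n q) borel (pattern_count k \<sigma> n) = distr Z.P borel (W n)" for n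
    unfolding W_def distr_pattern_count[OF \<sigma>]
    by (rule distr_symmetric_sum[OF prob_space_axioms sets_N U.prob_space_axioms sets_U atomless Q, symmetric])
  have int: "(\<integral>p. g (pattern_count k \<sigma> n p) \<partial>Maj n q) = (\<integral>z. g (W n z) \<partial>Z.P)"
    if g: "g \<in> borel_measurable borel" for g :: "real \<Rightarrow> real" and n
    using integral_distr[OF measurable_Maj g, of n "pattern_count k \<sigma> n"] integral_distr[OF W g, of n]
    by (simp add: law)
  have E: "(\<integral>p. pattern_count k \<sigma> n p \<partial>Maj n q) = (\<integral>z. W n z \<partial>Z.P)" for n
    using int[of "\<lambda>t. t" n] by simp
  have V: "(\<integral>p. (pattern_count k \<sigma> n p - c)\<^sup>2 \<partial>Maj n q) = (\<integral>z. (W n z - c)\<^sup>2 \<partial>Z.P)" for n c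
    using int[of "\<lambda>t. (t - c)\<^sup>2" n] by simp
  have D: "distr (Maj n q) borel (\<lambda>p. (pattern_count k \<sigma> n p - c) / d) = distr Z.P borel (\<lambda>z. (W n z - c) / d)" for n c d
  proof -
    have m: "(\<lambda>t. (t - c) / d) \<in> borel_measurable borel" by measurable
    show ?thesis
      using distr_distr[OF m measurable_Maj, of n "pattern_count k \<sigma> n"] distr_distr[OF m W, of n]
      by (simp add: law o_def)
  qed
  have "\<bar>symmetric_kernel Q k \<sigma> z\<bar> \<le> 1" for z
    by (simp add: symmetric_kernel_def)
  from Z.V_statistic_asymptotically_normal[OF K this symmetric_kernel_depends_on k]
  show ?thesis
    unfolding E V D W_def[symmetric] .
qed

end

section \<open>Realising the three ranges of q by label laws\<close>

lemma emeasure_reindexed_chain: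
  fixes N :: "'a :: {linorder_topology, second_countable_topology} measure"
  assumes "label_seq N" and p: "p \<in> perms n"
  shows "emeasure (iid_seq.P N) {x. chain D n (\<lambda>i. x (p i))} = emeasure (iid_seq.P N) {x. chain D n x}"
proof -
  interpret N: label_seq N by fact
  \<comment> \<open>The event is treated as a truth-valued random variable, so that exchangeability
    in the form of \<open>distr_reindex\<close> applies; its probability is the mass of
    \<open>True\<close>.\<close>
  have m: "chain D n \<in> measurable N.P (count_space UNIV)"
    using N.pred_chain by simp
  have "inj_on p {1..n}" using p permutes_inj_on by (auto simp: perms_def)
  from N.distr_reindex[OF m chain_depends_on this]
  have "emeasure (distr N.P (count_space UNIV) (\<lambda>x. chain D n (\<lambda>i. x (p i)))) {True} =
      emeasure (distr N.P (count_space UNIV) (chain D n)) {True}" by simp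
  then show ?thesis
    using measurable_compose[OF N.measurable_reindex m]
    by (simp add: emeasure_distr m N.space_P_UNIV vimage_def)
qed

lemma emeasure_geometric_chain:
  assumes r: "0 < r" "r < 1"
  shows "emeasure (iid_seq.P (measure_pmf (geometric_pmf (1 - r)))) {x. chain D n x} =
    ennreal (r ^ (\<Sum>i\<in>D \<inter> {1..<n}. i) / q_fact r n)"
  using geometric_chain[OF r, of D n 0] prod_one_minus_power[of r n] r by simp

lemma label_model_less_1:
  assumes q: "0 < q" "q < 1"
  shows "label_model (measure_pmf (geometric_pmf (1 - q))) (\<lambda>a b. a \<ge> b) q"
proof (intro label_model.intro label_model_axioms.intro label_seq_geometric q)
  fix n p assume p: "p \<in> perms n"
  have "{i \<in> {1..<n}. p i > p (i + 1)} \<inter> {1..<n} = {i. i \<in> {1..<n} \<and> p i > p (i + 1)}" by auto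
  then show "emeasure (iid_seq.P (measure_pmf (geometric_pmf (1 - q)))) {x. sorts (\<lambda>a b. a \<ge> b) n p x} =
      ennreal (q ^ maj n p / q_fact q n)"
    unfolding sorts_ge_iff_chain[OF p] emeasure_reindexed_chain[OF label_seq_geometric p]
      emeasure_geometric_chain[OF q] maj_def by simp
qed simp

lemma label_model_1: "label_model (uniform_measure lborel {0..1 :: real}) (\<lambda>a b. a \<ge> b) 1"
proof (intro label_model.intro label_model_axioms.intro label_seq_uniform)
  fix n p assume p: "p \<in> perms n"
  interpret N: label_seq "uniform_measure lborel {0..1 :: real}" by (rule label_seq_uniform)
  let ?D = "{i \<in> {1..<n}. p i > p (i + 1)}"
  \<comment> \<open>The labels range over all reals, so the threshold 0 in
    \<open>uniform_chain\<close> holds only almost surely.\<close>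
  have nonneg: "AE x in N.P. x n \<ge> 0"
  proof -
    have "AE z in uniform_measure lborel {0..1 :: real}. z \<ge> 0"
      by (subst AE_uniform_measure) auto
    then have "AE z in distr N.P (uniform_measure lborel {0..1 :: real}) (\<lambda>x. x n). z \<ge> 0"
      unfolding N.distr_coord .
    then show ?thesis by (subst (asm) AE_distr_iff) auto
  qed
  have "emeasure N.P {x. chain ?D n x} = emeasure N.P {x. chain ?D n x \<and> (n \<ge> 1 \<longrightarrow> x n \<ge> 0)}"
  proof (rule emeasure_eq_AE)
    show "AE x in N.P. x \<in> {x. chain ?D n x} \<longleftrightarrow> x \<in> {x. chain ?D n x \<and> (n \<ge> 1 \<longrightarrow> x n \<ge> 0)}"
      using nonneg by eventually_elim auto
    have "{x \<in> space N.P. chain ?D n x} \<in> sets N.P"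
      "{x \<in> space N.P. chain ?D n x \<and> (n \<ge> 1 \<longrightarrow> x n \<ge> 0)} \<in> sets N.P" by measurable
    then show "{x. chain ?D n x} \<in> sets N.P"
      "{x. chain ?D n x \<and> (n \<ge> 1 \<longrightarrow> x n \<ge> 0)} \<in> sets N.P"
      by (simp_all add: N.space_P_UNIV)
  qed
  also have "\<dots> = ennreal (1 / fact n)"
    using uniform_chain(1)[of 0 ?D n] by simp
  also have "(1 :: real) / fact n = 1 ^ maj n p / q_fact 1 n"
    by (simp add: q_fact_def q_int_def fact_prod)
  finally show "emeasure N.P {x. sorts (\<lambda>a b. a \<ge> b) n p x} = ennreal (1 ^ maj n p / q_fact 1 n)"
    unfolding sorts_ge_iff_chain[OF p] emeasure_reindexed_chain[OF label_seq_uniform p] .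
qed simp_all

text \<open>Labels of ratio 1 / q give (1 / q) ^ a / [n]_{1/q}!, where a is the sum of the ascents.
  Reversing every factor of the q-factorial gives [n]_q! = q ^ (n (n - 1) / 2) * [n]_{1/q}!, and a +
  maj = n (n - 1) / 2 leaves exactly q ^ maj / [n]_q!.\<close>

lemma label_model_greater_1:
  assumes q: "q > 1"
  shows "label_model (measure_pmf (geometric_pmf (1 - 1 / q))) (\<lambda>a b. a > b) q"
proof (intro label_model.intro label_model_axioms.intro label_seq_geometric)
  fix n p assume p: "p \<in> perms n"
  have r: "0 < 1 / q" "1 / q < 1" using q by simp_all
  let ?a = "\<Sum>i | i \<in> {1..<n} \<and> p i < p (i + 1). i"
  have "{i \<in> {1..<n}. p i < p (i + 1)} \<inter> {1..<n} = {i. i \<in> {1..<n} \<and> p i < p (i + 1)}" by auto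
  then have "emeasure (iid_seq.P (measure_pmf (geometric_pmf (1 - 1 / q)))) {x. sorts (\<lambda>a b. a > b) n p x} =
      ennreal ((1 / q) ^ ?a / q_fact (1 / q) n)"
    unfolding sorts_gt_iff_chain[OF p] emeasure_reindexed_chain[OF label_seq_geometric p]
      emeasure_geometric_chain[OF r] by simp
  also have "(1 / q) ^ ?a / q_fact (1 / q) n = q ^ maj n p / q_fact q n"
  proof -
    have "q_fact q n = (\<Prod>i=1..n. q ^ (i - 1) * q_int (1 / q) i)"
      unfolding q_fact_def by (intro prod.cong refl q_int_inverse) (use q in auto)
    also have "\<dots> = q ^ (\<Sum>i=1..n. i - 1) * q_fact (1 / q) n"
      by (simp add: prod.distrib power_sum q_fact_def)
    also have "\<dots> = q ^ ?a * q ^ maj n p * q_fact (1 / q) n"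
      unfolding ascent_sum[OF p, symmetric] power_add ..
    finally show ?thesis
      using q q_fact_pos[OF r(1), of n] by (simp add: power_divide)
  qed
  finally show "emeasure (iid_seq.P (measure_pmf (geometric_pmf (1 - 1 / q)))) {x. sorts (\<lambda>a b. a > b) n p x} =
      ennreal (q ^ maj n p / q_fact q n)" .
qed (use q in simp_all)

theorem theorem1p4:
  fixes q :: real and k :: nat and \<sigma> :: "nat \<Rightarrow> nat"
  assumes "q > 0" and "k \<ge> 1" and "\<sigma> \<in> perms k"
  shows "\<exists>s\<ge>0.
    (\<lambda>n. prob_space.variance (Maj n q) (pattern_count k \<sigma> n) / real n ^ (2 * k - 1))
       \<longlonglongrightarrow> s\<^sup>2 \<and>
    weak_conv_m
      (\<lambda>n. distr (Maj n q) borel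
         (\<lambda>p. (pattern_count k \<sigma> n p - prob_space.expectation (Maj n q) (pattern_count k \<sigma> n))
               / real n powr (real k - 1 / 2)))
      (centered_normal s)"
proof (cases q "1 :: real" rule: linorder_cases)
  case less
  show ?thesis
    by (rule label_model.pattern_count_asymptotically_normal[OF label_model_less_1[OF \<open>q > 0\<close> less] assms(2,3)])
next
  case equal
  show ?thesis
    unfolding equal by (rule label_model.pattern_count_asymptotically_normal[OF label_model_1 assms(2,3)])
next
  case greater
  show ?thesis
    by (rule label_model.pattern_count_asymptotically_normal[OF label_model_greater_1[OF greater] assms(2,3)])
qed

end
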